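(* Let $\mathcal{S}$ be Thompson's semigroup. Every derivation on the Banach algebra $\mathfrak{B}(\mathcal{S})$ is spatial and induced by an operator in $\mathcal{L}(\mathcal{S})$; that is, for every derivation $D:\mathfrak{B}(\mathcal{S})\to\mathfrak{B}(\mathcal{S})$ there exists $T\in\mathcal{L}(\mathcal{S})$ such that $D(A)=TA-AT$ for all $A\in\mathfrak{B}(\mathcal{S})$.
   Context: Thompson's semigroup $\mathcal{S}$ is the discrete cancellative semigroup with unit $e$ given by the presentation $\mathcal{S}=\langle X_0,X_1,X_2,\ldots \mid X_jX_i=X_iX_{j+1},\ j>i\rangle$. $l^2(\mathcal{S})$ is the Hilbert space of square-summable complex functions on $\mathcal{S}$ with orthonormal basis $(\delta_s)_{s\in\mathcal{S}}$. For $f,g\in l^2(\mathcal{S})$ put $(f*g)(s)=\sum_{uv=s}f(u)g(v)$ and $L_fg=f*g$. $\mathcal{L}(\mathcal{S})$ is the algebra of all left convolution operators $L_f$ ($f\in l^2(\mathcal{S})$) that are bounded operators on $l^2(\mathcal{S})$. Write $L_s=L_{\delta_s}$. $\mathfrak{B}(\mathcal{S})\subseteq\mathcal{L}(\mathcal{S})$ is the Banach algebra generated by $\{L_s:s\in\mathcal{S}\}$ in $B(l^2(\mathcal{S}))$ (norm-closed subalgebra). A derivation on a Banach algebra $\mathcal{A}$ is a linear map $D:\mathcal{A}\to\mathcal{A}$ (not assumed continuous) with $D(AB)=AD(B)+D(A)B$ for all $A,B\in\mathcal{A}$. A derivation $D$ on a Banach algebra $\mathfrak{B}\subseteq B(\mathcal{H})$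 is spatial if there is a bounded operator $T\in B(\mathcal{H})$ with $D(A)=TA-AT$ for each $A\in\mathfrak{B}$. *)

theory Defs
  imports "HOL-Analysis.Analysis"
begin

section \<open>Thompson's semigroup\<close>

text \<open>Words in the generators \<open>X\<^sub>0, X\<^sub>1, \<dots>\<close> are lists of indices; \<open>thompson_eq\<close> is the least
  congruence on the free monoid of words containing \<open>X\<^sub>j X\<^sub>i = X\<^sub>i X\<^sub>j\<^sub>+\<^sub>1\<close> for \<open>j > i\<close>.\<close>

inductive thompson_eq :: "nat list \<Rightarrow> nat list \<Rightarrow> bool" where
  relation: "i < j \<Longrightarrow> thompson_eq [j, i] [i, Suc j]"
| refl: "thompson_eq u u"
| sym: "thompson_eq u v \<Longrightarrow> thompson_eq v u"
| trans: "thompson_eq u v \<Longrightarrow> thompson_eq v w \<Longrightarrow> thompson_eq u w"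
| append: "thompson_eq u u' \<Longrightarrow> thompson_eq v v' \<Longrightarrow> thompson_eq (u @ v) (u' @ v')"

quotient_type thompson = "nat list" / thompson_eq
  by (intro equivpI reflpI sympI transpI)
     (blast intro: thompson_eq.intros)+

instantiation thompson :: monoid_mult
begin

lift_definition one_thompson :: thompson is "[]" .

lift_definition times_thompson :: "thompson \<Rightarrow> thompson \<Rightarrow> thompson" is "(@)"
  by (rule thompson_eq.append)

instance
  by standard (transfer, simp add: thompson_eq.refl)+

end

lift_definition gen :: "nat \<Rightarrow> thompson" is "\<lambda>i. [i]" .

lemma gen_relation: "i < j \<Longrightarrow> gen j * gen i = gen i * gen (Suc j)"
  by transfer (simp add: thompson_eq.relation)

text \<open>Left cancellation, via the left action of the semigroup on words that moves each newly
  prepended generator to its place. It is used only to see that the operators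
  of left translation are bounded.\<close>

fun insert_gen :: "nat \<Rightarrow> nat list \<Rightarrow> nat list" where
  "insert_gen j [] = [j]"
| "insert_gen j (i # w) = (if i < j then i # insert_gen (Suc j) w else j # i # w)"

lemma insert_gen_swap:
  "i < j \<Longrightarrow> insert_gen j (insert_gen i w) = insert_gen i (insert_gen (Suc j) w)"
  by (induction w arbitrary: i j) auto

lemma insert_gen_inj: "insert_gen j u = insert_gen j v \<Longrightarrow> u = v"
proof (induction u arbitrary: j v)
  case Nil
  have "insert_gen (Suc j) w \<noteq> []" for w
    by (cases w) auto
  then show ?case
    using Nil by (cases v) (auto split: if_splits)
next
  case (Cons a u)
  show ?case
  proof (cases v)
    case Nil
    have "insert_gen (Suc j) u \<noteq> []"
      by (cases u) auto
    then show ?thesis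
      using Cons.prems Nil by (auto split: if_splits)
  next
    case (Cons b w)
    then show ?thesis
      using Cons.prems Cons.IH[of "Suc j" w] by (auto split: if_splits)
  qed
qed

lemma thompson_eq_foldr_insert_gen:
  "thompson_eq u v \<Longrightarrow> foldr insert_gen u x = foldr insert_gen v x"
  by (induction arbitrary: x rule: thompson_eq.induct) (auto simp: insert_gen_swap)

lemma thompson_eq_insert_gen: "thompson_eq (j # w) (insert_gen j w)"
proof (induction w arbitrary: j)
  case Nil
  show ?case by (simp add: thompson_eq.refl)
next
  case (Cons i w)
  show ?case
  proof (cases "i < j")
    case True
    have "thompson_eq ([j, i] @ w) ([i, Suc j] @ w)"
      using True by (intro thompson_eq.append thompson_eq.relation thompson_eq.refl)
    moreover have "thompson_eq ([i] @ Suc j # w) ([i] @ insert_gen (Suc j) w)"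
      by (intro thompson_eq.append thompson_eq.refl Cons.IH)
    ultimately show ?thesis
      using True by (auto intro: thompson_eq.trans)
  qed (simp add: thompson_eq.refl)
qed

lemma thompson_eq_normal_form: "thompson_eq w (foldr insert_gen w [])"
proof (induction w)
  case Nil
  show ?case by (simp add: thompson_eq.refl)
next
  case (Cons j w)
  have "thompson_eq ([j] @ w) ([j] @ foldr insert_gen w [])"
    by (intro thompson_eq.append thompson_eq.refl Cons.IH)
  then show ?case
    using thompson_eq_insert_gen[of j "foldr insert_gen w []"] by (auto intro: thompson_eq.trans)
qed

lemma foldr_insert_gen_inj: "foldr insert_gen w u = foldr insert_gen w v \<Longrightarrow> u = v"
  by (induction w) (auto dest: insert_gen_inj)

lemma thompson_left_cancel:
  fixes s u v :: thompson
  assumes "s * u = s * v"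
  shows "u = v"
  using assms
proof transfer
  fix s u v
  assume "thompson_eq (s @ u) (s @ v)"
  then have "foldr insert_gen (s @ u) [] = foldr insert_gen (s @ v) []"
    by (rule thompson_eq_foldr_insert_gen)
  then have "foldr insert_gen u [] = foldr insert_gen v []"
    by (auto dest: foldr_insert_gen_inj)
  then show "thompson_eq u v"
    by (metis thompson_eq_normal_form thompson_eq.sym thompson_eq.trans)
qed

section \<open>The Hilbert space of square-summable functions\<close>

typedef 'a ell2 = "{f :: 'a \<Rightarrow> complex. (\<lambda>x. (cmod (f x))\<^sup>2) summable_on UNIV}"
  morphisms coord Abs_ell2
  by (intro exI[of _ "\<lambda>_. 0"]) simp

setup_lifting type_definition_ell2

lemma square_summable_add:
  fixes f g :: "'a \<Rightarrow> complex"
  assumes "(\<lambda>x. (cmod (f x))\<^sup>2) summable_on UNIV" "(\<lambda>x. (cmod (g x))\<^sup>2) summable_on UNIV"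
  shows "(\<lambda>x. (cmod (f x + g x))\<^sup>2) summable_on UNIV"
proof (rule summable_on_comparison_test)
  show "(\<lambda>x. 2 * (cmod (f x))\<^sup>2 + 2 * (cmod (g x))\<^sup>2) summable_on UNIV"
    using assms by (intro summable_on_add summable_on_cmult_right)
  fix x
  have "(cmod (f x + g x))\<^sup>2 \<le> (cmod (f x) + cmod (g x))\<^sup>2"
    by (intro power_mono norm_triangle_ineq) auto
  also have "\<dots> \<le> 2 * (cmod (f x))\<^sup>2 + 2 * (cmod (g x))\<^sup>2"
    using sum_squares_bound[of "cmod (f x)" "cmod (g x)"] by (simp add: power2_sum)
  finally show "(cmod (f x + g x))\<^sup>2 \<le> 2 * (cmod (f x))\<^sup>2 + 2 * (cmod (g x))\<^sup>2" .
qed auto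

lemma square_summable_scale:
  fixes f :: "'a \<Rightarrow> complex"
  assumes "(\<lambda>x. (cmod (f x))\<^sup>2) summable_on UNIV"
  shows "(\<lambda>x. (cmod (c * f x))\<^sup>2) summable_on UNIV"
  using assms by (simp add: norm_mult power_mult_distrib summable_on_cmult_right)

lemma square_summable_inner:
  fixes f g :: "'a \<Rightarrow> complex"
  assumes "(\<lambda>x. (cmod (f x))\<^sup>2) summable_on UNIV" "(\<lambda>x. (cmod (g x))\<^sup>2) summable_on UNIV"
  shows "(\<lambda>x. f x \<bullet> g x) summable_on UNIV"
proof (rule Infinite_Sum.abs_summable_summable, rule Infinite_Sum.abs_summable_on_comparison_test)
  have "(\<lambda>x. (cmod (f x))\<^sup>2 + (cmod (g x))\<^sup>2) summable_on UNIV"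
    using assms by (rule summable_on_add)
  then show "(\<lambda>x. norm ((cmod (f x))\<^sup>2 + (cmod (g x))\<^sup>2)) summable_on UNIV"
    by simp
  fix x
  have "\<bar>f x \<bullet> g x\<bar> \<le> cmod (f x) * cmod (g x)"
    by (rule Cauchy_Schwarz_ineq2)
  also have "\<dots> \<le> (cmod (f x))\<^sup>2 + (cmod (g x))\<^sup>2"
  proof -
    have "0 \<le> cmod (f x) * cmod (g x)"
      by simp
    then show ?thesis
      using sum_squares_bound[of "cmod (f x)" "cmod (g x)"] unfolding mult.assoc by linarith
  qed
  finally show "norm (f x \<bullet> g x) \<le> norm ((cmod (f x))\<^sup>2 + (cmod (g x))\<^sup>2)"
    by simp
qed

text \<open>The real inner product below is the real part of the usual complex inner product, so it
  induces the \<open>\<ell>\<^sup>2\<close> norm; see \<open>norm_ell2\<close>. The complex structure is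
  given by the operation \<open>cscale\<close> below.\<close>

instantiation ell2 :: (type) real_inner
begin

lift_definition zero_ell2 :: "'a ell2" is "\<lambda>_. 0" by simp

lift_definition plus_ell2 :: "'a ell2 \<Rightarrow> 'a ell2 \<Rightarrow> 'a ell2" is "\<lambda>f g x. f x + g x"
  by (rule square_summable_add)

lift_definition uminus_ell2 :: "'a ell2 \<Rightarrow> 'a ell2" is "\<lambda>f x. - f x" by simp

lift_definition minus_ell2 :: "'a ell2 \<Rightarrow> 'a ell2 \<Rightarrow> 'a ell2" is "\<lambda>f g x. f x - g x"
proof -
  fix f g :: "'a \<Rightarrow> complex"
  assume "(\<lambda>x. (cmod (f x))\<^sup>2) summable_on UNIV" "(\<lambda>x. (cmod (g x))\<^sup>2) summable_on UNIV"
  then show "(\<lambda>x. (cmod (f x - g x))\<^sup>2) summable_on UNIV"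
    using square_summable_add[of f "\<lambda>x. - g x"] by simp
qed

lift_definition scaleR_ell2 :: "real \<Rightarrow> 'a ell2 \<Rightarrow> 'a ell2" is "\<lambda>r f x. complex_of_real r * f x"
  by (rule square_summable_scale)

lift_definition inner_ell2 :: "'a ell2 \<Rightarrow> 'a ell2 \<Rightarrow> real"
  is "\<lambda>f g. \<Sum>\<^sub>\<infinity>x. f x \<bullet> g x" .

definition "norm_ell2 (f :: 'a ell2) = sqrt (f \<bullet> f)"
definition "sgn_ell2 (f :: 'a ell2) = inverse (norm f) *\<^sub>R f"
definition "dist_ell2 (f :: 'a ell2) g = norm (f - g)"
definition [code del]:
  "(uniformity :: ('a ell2 \<times> 'a ell2) filter) = (INF e\<in>{0<..}. principal {(x, y). dist x y < e})"
definition [code del]: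
  "open (U :: 'a ell2 set) \<longleftrightarrow>
    (\<forall>x\<in>U. eventually (\<lambda>(x', y). x' = x \<longrightarrow> y \<in> U) uniformity)"

instance
proof
  fix f g h :: "'a ell2" and r s :: real
  show "f + g + h = f + (g + h)" "f + g = g + f" "0 + f = f" "- f + f = 0" "f - g = f + - g"
    by (transfer; simp add: algebra_simps)+
  show "r *\<^sub>R (f + g) = r *\<^sub>R f + r *\<^sub>R g" "(r + s) *\<^sub>R f = r *\<^sub>R f + s *\<^sub>R f"
    "r *\<^sub>R s *\<^sub>R f = (r * s) *\<^sub>R f" "1 *\<^sub>R f = f"
    by (transfer; simp add: algebra_simps)+
  show "sgn f = inverse (norm f) *\<^sub>R f" "dist f g = norm (f - g)" "norm f = sqrt (f \<bullet> f)"
    by (fact sgn_ell2_def dist_ell2_def norm_ell2_def)+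
  show "(uniformity :: ('a ell2 \<times> 'a ell2) filter) = (INF e\<in>{0<..}. principal {(x, y). dist x y < e})"
    by (fact uniformity_ell2_def)
  show "open U \<longleftrightarrow> (\<forall>x\<in>U. eventually (\<lambda>(x', y). x' = x \<longrightarrow> y \<in> U) uniformity)"
    for U :: "'a ell2 set"
    by (fact open_ell2_def)
  show "f \<bullet> g = g \<bullet> f"
    by transfer (simp add: inner_commute)
  show "(f + g) \<bullet> h = f \<bullet> h + g \<bullet> h"
    by transfer (simp add: inner_add_left infsum_add square_summable_inner)
  show "(r *\<^sub>R f) \<bullet> g = r * (f \<bullet> g)"
    by transfer (simp flip: scaleR_conv_of_real add: infsum_cmult_right')
  show "0 \<le> f \<bullet> f"
    by transfer (simp add: infsum_nonneg)
  show "f \<bullet> f = 0 \<longleftrightarrow> f = 0"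
  proof transfer
    fix f :: "'a \<Rightarrow> complex"
    assume f: "(\<lambda>x. (cmod (f x))\<^sup>2) summable_on UNIV"
    show "(\<Sum>\<^sub>\<infinity>x. f x \<bullet> f x) = 0 \<longleftrightarrow> f = (\<lambda>_. 0)"
    proof
      assume "(\<Sum>\<^sub>\<infinity>x. f x \<bullet> f x) = 0"
      then have "f x \<bullet> f x = 0" for x
        by (intro nonneg_infsum_le_0D[of "\<lambda>x. f x \<bullet> f x" UNIV])
           (auto simp: f square_summable_inner)
      then show "f = (\<lambda>_. 0)"
        by auto
    qed auto
  qed
qed

end

lemma norm_ell2: "norm f = sqrt (\<Sum>\<^sub>\<infinity>x. (cmod (coord f x))\<^sup>2)"
  by (simp add: norm_eq_sqrt_inner inner_ell2.rep_eq power2_norm_eq_inner)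

lift_definition cscale :: "complex \<Rightarrow> 'a ell2 \<Rightarrow> 'a ell2" is "\<lambda>c f x. c * f x"
  by (rule square_summable_scale)

lemma norm_cscale: "norm (cscale c f) = cmod c * norm f"
  by (simp add: norm_ell2 cscale.rep_eq norm_mult power_mult_distrib infsum_cmult_right'
      real_sqrt_mult)

lemma bounded_linear_cscale: "bounded_linear (cscale c)"
proof (rule bounded_linear_intro)
  show "cscale c (f + g) = cscale c f + cscale c g" "cscale c (r *\<^sub>R f) = r *\<^sub>R cscale c f"
    for f g :: "'a ell2" and r
    by (transfer; simp add: algebra_simps)+
  show "norm (cscale c f) \<le> norm f * cmod c" for f :: "'a ell2"
    by (simp add: norm_cscale)
qed

text \<open>The basis vectors \<open>\<delta>\<^sub>s\<close>.\<close>

lift_definition delta :: "'a \<Rightarrow> 'a ell2" is "\<lambda>s x. if x = s then 1 else 0"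
proof -
  fix s :: 'a
  have "(\<lambda>x. (cmod (if x = s then 1 else 0))\<^sup>2) summable_on {s}"
    by simp
  then show "(\<lambda>x. (cmod (if x = s then 1 else 0))\<^sup>2) summable_on UNIV"
    by (rule summable_on_cong_neutral[THEN iffD1, rotated 3]) auto
qed

section \<open>Operator algebras\<close>

text \<open>The type \<open>'a ell2 \<Rightarrow>\<^sub>L 'a ell2\<close> consists of the bounded real-linear operators with the operator
  norm; \<open>B(\<ell>\<^sup>2)\<close> is its subset of complex-linear ones.\<close>

definition bounded_ops :: "('a ell2 \<Rightarrow>\<^sub>L 'a ell2) set" where
  "bounded_ops = {T. \<forall>c f. blinfun_apply T (cscale c f) = cscale c (blinfun_apply T f)}"

definition scale_op :: "complex \<Rightarrow> ('a ell2 \<Rightarrow>\<^sub>L 'a ell2) \<Rightarrow> ('a ell2 \<Rightarrow>\<^sub>L 'a ell2)" where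
  "scale_op c T = Blinfun (\<lambda>f. cscale c (blinfun_apply T f))"

lemma scale_op_apply [simp]: "blinfun_apply (scale_op c T) f = cscale c (blinfun_apply T f)"
  unfolding scale_op_def
  by (simp add: bounded_linear_Blinfun_apply
      bounded_linear_compose[OF bounded_linear_cscale blinfun.bounded_linear_right])

definition subalgebra :: "('a ell2 \<Rightarrow>\<^sub>L 'a ell2) set \<Rightarrow> bool" where
  "subalgebra A \<longleftrightarrow> A \<subseteq> bounded_ops \<and> 0 \<in> A \<and> (\<forall>S\<in>A. \<forall>T\<in>A. S + T \<in> A)
    \<and> (\<forall>c. \<forall>T\<in>A. scale_op c T \<in> A) \<and> (\<forall>S\<in>A. \<forall>T\<in>A. S o\<^sub>L T \<in> A)"

definition banach_algebra_generated :: "('a ell2 \<Rightarrow>\<^sub>L 'a ell2) set \<Rightarrow> ('a ell2 \<Rightarrow>\<^sub>L 'a ell2) set" where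
  "banach_algebra_generated G = (\<lambda>A. subalgebra A \<and> closed A) hull G"

definition derivation_on :: "('a ell2 \<Rightarrow>\<^sub>L 'a ell2) set
    \<Rightarrow> (('a ell2 \<Rightarrow>\<^sub>L 'a ell2) \<Rightarrow> ('a ell2 \<Rightarrow>\<^sub>L 'a ell2)) \<Rightarrow> bool" where
  "derivation_on A D \<longleftrightarrow> D ` A \<subseteq> A
    \<and> (\<forall>S\<in>A. \<forall>T\<in>A. D (S + T) = D S + D T)
    \<and> (\<forall>c. \<forall>T\<in>A. D (scale_op c T) = scale_op c (D T))
    \<and> (\<forall>S\<in>A. \<forall>T\<in>A. D (S o\<^sub>L T) = (S o\<^sub>L D T) + (D S o\<^sub>L T))"

lemma subalgebra_bounded_ops: "subalgebra (bounded_ops :: ('a ell2 \<Rightarrow>\<^sub>L 'a ell2) set)"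
proof -
  have lin: "cscale c (f + g) = cscale c f + cscale c g" "cscale c 0 = (0 :: 'a ell2)"
    for c and f g :: "'a ell2"
    by (transfer; simp add: algebra_simps)+
  have comm: "cscale c (cscale d f) = cscale d (cscale c f)" for c d and f :: "'a ell2"
    by transfer (simp add: mult.left_commute)
  show ?thesis
    unfolding subalgebra_def bounded_ops_def
    by (simp add: blinfun.add_left lin)
       (metis comm)
qed

lemma closed_bounded_ops: "closed bounded_ops"
proof -
  have eq: "bounded_ops = (\<Inter>c. \<Inter>f. {T. blinfun_apply T (cscale c f) = cscale c (blinfun_apply T f)})"
    by (auto simp: bounded_ops_def)
  show ?thesis
    unfolding eq
    by (intro closed_INT ballI closed_Collect_eq blinfun.continuous_on
        bounded_linear.continuous_on[OF bounded_linear_cscale] continuous_intros)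
qed

lemma banach_algebra_generated:
  assumes "G \<subseteq> bounded_ops"
  shows "subalgebra (banach_algebra_generated G)" "closed (banach_algebra_generated G)"
    "G \<subseteq> banach_algebra_generated G"
proof -
  have "bounded_ops \<in> {A. (subalgebra A \<and> closed A) \<and> G \<subseteq> A}"
    using assms subalgebra_bounded_ops closed_bounded_ops by simp
  then have sub: "banach_algebra_generated G \<subseteq> bounded_ops"
    unfolding banach_algebra_generated_def hull_def by (rule Inter_lower)
  show "subalgebra (banach_algebra_generated G)"
    unfolding subalgebra_def
    by (intro conjI sub)
       (simp_all add: banach_algebra_generated_def hull_def subalgebra_def)
  show "closed (banach_algebra_generated G)"
    unfolding banach_algebra_generated_def hull_def by (intro closed_Inter) auto
  show "G \<subseteq> banach_algebra_generated G"
    unfolding banach_algebra_generated_def by (rule hull_subset)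
qed

section \<open>Left convolution operators\<close>

text \<open>Every element of the semigroup has only finitely many factorisations, so the sum below is
  always a finite one.\<close>

definition convolution :: "(thompson \<Rightarrow> complex) \<Rightarrow> (thompson \<Rightarrow> complex) \<Rightarrow> thompson \<Rightarrow> complex" where
  "convolution f g s = (\<Sum>\<^sub>\<infinity>(u, v) | u * v = s. f u * g v)"

text \<open>\<open>L\<^sub>f\<close> is defined everywhere on \<open>\<ell>\<^sup>2\<close>, takes values in \<open>\<ell>\<^sup>2\<close> and is bounded, and \<open>T = L\<^sub>f\<close>.\<close>

definition is_left_convolution :: "thompson ell2 \<Rightarrow> (thompson ell2 \<Rightarrow>\<^sub>L thompson ell2) \<Rightarrow> bool" where
  "is_left_convolution f T \<longleftrightarrow>
    (\<forall>g. coord (blinfun_apply T g) = convolution (coord f) (coord g))"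

definition left_convolution_algebra :: "(thompson ell2 \<Rightarrow>\<^sub>L thompson ell2) set" where
  "left_convolution_algebra = {T \<in> bounded_ops. \<exists>f. is_left_convolution f T}"

lemma is_left_convolution_unique:
  assumes "is_left_convolution f S" "is_left_convolution f T"
  shows "S = T"
  using assms by (intro blinfun_eqI) (simp add: is_left_convolution_def flip: coord_inject)

lemma convolution_delta_translate:
  "convolution (coord (delta s)) g (s * v) = g v"
proof -
  have "convolution (coord (delta s)) g (s * v) = (\<Sum>\<^sub>\<infinity>(u, w)\<in>{(s, v)}. coord (delta s) u * g w)"
    unfolding convolution_def
    by (rule infsum_cong_neutral) (auto simp: delta.rep_eq split: if_splits dest: thompson_left_cancel)
  then show ?thesis
    by (simp add: delta.rep_eq)
qed

lemma convolution_delta_outside: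
  assumes "t \<notin> range ((*) s)"
  shows "convolution (coord (delta s)) g t = 0"
  unfolding convolution_def
  using assms by (intro infsum_0) (auto simp: delta.rep_eq)

lemma convolution_delta_has_sum:
  fixes g :: "thompson ell2"
  shows "((\<lambda>t. (cmod (convolution (coord (delta s)) (coord g) t))\<^sup>2) has_sum (norm g)\<^sup>2) UNIV"
proof -
  let ?c = "\<lambda>t. (cmod (convolution (coord (delta s)) (coord g) t))\<^sup>2"
  have "((\<lambda>x. (cmod (coord g x))\<^sup>2) has_sum (\<Sum>\<^sub>\<infinity>x. (cmod (coord g x))\<^sup>2)) UNIV"
    using coord[of g] by (simp add: has_sum_infsum)
  moreover have "(\<Sum>\<^sub>\<infinity>x. (cmod (coord g x))\<^sup>2) = (norm g)\<^sup>2"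
    by (simp add: norm_ell2 infsum_nonneg)
  ultimately have "((?c \<circ> (*) s) has_sum (norm g)\<^sup>2) UNIV"
    by (simp add: o_def convolution_delta_translate)
  moreover have "inj ((*) s)"
    by (rule injI) (rule thompson_left_cancel)
  ultimately have "(?c has_sum (norm g)\<^sup>2) (range ((*) s))"
    by (simp add: has_sum_reindex)
  then show ?thesis
    by (rule has_sum_cong_neutral[THEN iffD1, rotated 3])
       (auto simp: convolution_delta_outside)
qed

lemma coord_left_translate:
  "coord (Abs_ell2 (convolution (coord (delta s)) (coord g))) = convolution (coord (delta s)) (coord g)"
  using convolution_delta_has_sum[of s g]
  by (intro Abs_ell2_inverse) (auto simp: summable_on_def)

text \<open>\<open>left_translate s\<close> is the operator \<open>L\<^sub>s\<close>, the convolution operator of \<open>\<delta>\<^sub>s\<close>;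
  see \<open>is_left_convolution_left_translate\<close>.\<close>

definition left_translate :: "thompson \<Rightarrow> (thompson ell2 \<Rightarrow>\<^sub>L thompson ell2)" where
  "left_translate s = Blinfun (\<lambda>g. Abs_ell2 (convolution (coord (delta s)) (coord g)))"

lemma bounded_linear_left_translate:
  "bounded_linear (\<lambda>g. Abs_ell2 (convolution (coord (delta s)) (coord g)))"
proof (rule bounded_linear_intro)
  fix f g :: "thompson ell2" and r :: real
  let ?T = "\<lambda>g. Abs_ell2 (convolution (coord (delta s)) (coord g))"
  show "?T (f + g) = ?T f + ?T g"
  proof (rule coord_inject[THEN iffD1], rule ext)
    fix t
    show "coord (?T (f + g)) t = coord (?T f + ?T g) t"
      unfolding coord_left_translate plus_ell2.rep_eq[of "?T f"]
      by (cases "t \<in> range ((*) s)")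
         (auto simp: plus_ell2.rep_eq convolution_delta_translate convolution_delta_outside)
  qed
  show "?T (r *\<^sub>R f) = r *\<^sub>R ?T f"
  proof (rule coord_inject[THEN iffD1], rule ext)
    fix t
    show "coord (?T (r *\<^sub>R f)) t = coord (r *\<^sub>R ?T f) t"
      unfolding coord_left_translate scaleR_ell2.rep_eq[of _ "?T f"]
      by (cases "t \<in> range ((*) s)")
         (auto simp: scaleR_ell2.rep_eq convolution_delta_translate convolution_delta_outside)
  qed
  show "norm (?T g) \<le> norm g * 1"
    unfolding norm_ell2[of "?T g"] coord_left_translate
    by (simp add: infsumI[OF convolution_delta_has_sum])
qed

lemma is_left_convolution_left_translate: "is_left_convolution (delta s) (left_translate s)"
  by (simp add: is_left_convolution_def left_translate_def coord_left_translate
      bounded_linear_Blinfun_apply bounded_linear_left_translate)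

lemma left_translate_in_bounded_ops: "left_translate s \<in> bounded_ops"
proof -
  have "coord (blinfun_apply (left_translate s) (cscale c f)) t
      = coord (cscale c (blinfun_apply (left_translate s) f)) t" for c f t
    using is_left_convolution_left_translate[of s]
    unfolding is_left_convolution_def cscale.rep_eq[of c "blinfun_apply (left_translate s) f"]
    by (cases "t \<in> range ((*) s)")
       (auto simp: cscale.rep_eq convolution_delta_translate convolution_delta_outside)
  then show ?thesis
    unfolding bounded_ops_def by (auto intro!: coord_inject[THEN iffD1])
qed

definition thompson_banach_algebra :: "(thompson ell2 \<Rightarrow>\<^sub>L thompson ell2) set" where
  "thompson_banach_algebra = banach_algebra_generated (range left_translate)"

end

theory Submission
  imports Defs
begin

text \<open>
  Write \<open>c s = D L\<^sub>s \<delta>\<^sub>1\<close>. Left translations commute with the right translations \<open>R\<^sub>t\<close>, hence so does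
  every operator of the Banach algebra, and such an operator is determined by its value at \<open>\<delta>\<^sub>1\<close>.
  The derivation rule becomes the cocycle identity \<open>c (s t) = L\<^sub>s (c t) + R\<^sub>t (c s)\<close>, and \<open>D\<close> is
  induced by \<open>T = L\<^sub>f\<close>, if this is a bounded operator, as soon as \<open>c s = R\<^sub>s f - L\<^sub>s f\<close> for every generator \<open>s\<close>.

  If such an \<open>f\<close> exists with \<open>f 1 = 0\<close>, it can be read off from \<open>c\<close>: for \<open>n\<close> beyond all letters of
  \<open>v\<close> the relations give \<open>X\<^sub>n v = v X\<^sub>n\<^sub>+\<^sub>l\<close> with \<open>l\<close> the length of \<open>v\<close>, so for \<open>v \<noteq> 1\<close> the element
  \<open>X\<^sub>n v\<close> is not divisible by \<open>X\<^sub>n\<close> on the right and the value of \<open>c X\<^sub>n\<close> at \<open>X\<^sub>n v\<close> must be \<open>- f v\<close>.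
  Conversely, the cocycle identity applied to \<open>X\<^sub>m X\<^sub>n\<^sub>+\<^sub>1 = X\<^sub>n X\<^sub>m\<close> shows that this value is the same
  for all large \<open>n\<close>; taking its negative as the definition of \<open>f\<close> (\<open>symbol\<close>), the same identity
  evaluated at \<open>X\<^sub>n t\<close> gives \<open>c X\<^sub>i = R f - L f\<close> at every \<open>t\<close> whose length is not 1
  (\<open>cocycle_gen_eq_commutator\<close>). At length 1 the commutator vanishes, and so must \<open>c X\<^sub>i\<close>
  (\<open>coord_cocycle_gen_gen\<close>): the relations kill the off-diagonal values \<open>c X\<^sub>i (X\<^sub>m)\<close>, and a diagonal
  value \<open>a\<close> would make \<open>c\<close> take the value \<open>k a\<close> at the \<open>k\<close>-th power of the generator, which is
  unbounded in \<open>k\<close> although all \<open>L\<^sub>s\<close> have norm at most 1.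

  The diagonal values and the boundedness of \<open>L\<^sub>f\<close> need \<open>D\<close> to be bounded. Continuity is automatic
  (\<open>D_bounded\<close>) by a gliding hump: the powers of \<open>W = L\<^sub>s\<close> for \<open>s = X\<^sub>0\<close> are isometries that push
  supports to arbitrarily large length, so that the contributions of all later terms of a series
  \<open>\<Sum>\<^sub>j W\<^sup>N\<^sup>j A\<^sub>j\<close> to its image under \<open>D\<close> are, up to a small error, invisible below a given length.
  With \<open>A\<^sub>j\<close> small and \<open>D A\<^sub>j\<close> huge, the image of the sum would have infinite norm.

  Boundedness of \<open>L\<^sub>f\<close> (\<open>sum_convolution_symbol_le\<close>) then follows because on any finite set of
  coordinates \<open>- (f * g)\<close> coincides with a translate of \<open>D L\<^sub>s g'\<close>, where \<open>s = X\<^sub>n\<close> with \<open>n\<close> large and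
  \<open>g'\<close> is a finite truncation of \<open>g\<close>. Finally \<open>D\<close> and the commutator with \<open>T\<close> are continuous derivations that agree on
  the generators, hence everywhere (\<open>D_eq_commutator\<close>).
\<close>

section \<open>Normal forms and right cancellation\<close>

text \<open>The list is the sequence of indices of the unique expression of an element as a product of
  generators with nondecreasing indices.\<close>

lift_definition normal_form :: "thompson \<Rightarrow> nat list" is "\<lambda>w. foldr insert_gen w []"
  by (rule thompson_eq_foldr_insert_gen)

lemma normal_form_inject: "normal_form u = normal_form v \<longleftrightarrow> u = v"
proof transfer
  fix u v
  show "(foldr insert_gen u [] = foldr insert_gen v []) = thompson_eq u v"
    by (metis thompson_eq_normal_form thompson_eq_foldr_insert_gen thompson_eq.sym
        thompson_eq.trans)
qed

lemma normal_form_one [simp]: "normal_form 1 = []"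
  by transfer simp

lemma normal_form_gen [simp]: "normal_form (gen i) = [i]"
  by transfer simp

lemma normal_form_gen_times [simp]:
  "normal_form (gen i * s) = insert_gen i (normal_form s)"
  by transfer simp

lemma thompson_induct [case_names one gen_times]:
  assumes "P 1" and "\<And>i s. P s \<Longrightarrow> P (gen i * s)"
  shows "P s"
proof -
  have "P (abs_thompson w)" for w
  proof (induction w)
    case Nil
    then show ?case
      using assms(1) by (simp add: one_thompson_def)
  next
    case (Cons i w)
    have "abs_thompson (i # w) = gen i * abs_thompson w"
      by (simp add: gen_def times_thompson.abs_eq)
    with Cons assms(2) show ?case
      by simp
  qed
  then show ?thesis
    by (metis Quotient3_abs_rep Quotient3_thompson)
qed

lemma length_insert_gen [simp]: "length (insert_gen i w) = Suc (length w)"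
  by (induction w arbitrary: i) auto

lemma subset_insert_gen: "set w \<subseteq> set (insert_gen i w)"
  by (induction w arbitrary: i) auto

lemma insert_gen_ge: "\<exists>k\<in>set (insert_gen i w). i \<le> k"
proof (induction w arbitrary: i)
  case (Cons a w)
  obtain k where "k \<in> set (insert_gen (Suc i) w)" "i \<le> k"
    using Cons.IH[of "Suc i"] Suc_leD by blast
  then show ?case
    by auto
qed auto

lemma insert_gen_append:
  "\<forall>k\<in>set w. k < n \<Longrightarrow> insert_gen n w = w @ [n + length w]"
proof (induction w arbitrary: n)
  case (Cons a w)
  then have "\<forall>k\<in>set w. k < Suc n"
    by auto
  with Cons show ?case
    by auto
qed auto

text \<open>Left multiplication by a generator either appends the new letter at the end, after passing all
  the others, or leaves the last letter in place.\<close>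

lemma insert_gen_eq_snoc:
  assumes "insert_gen i y = v @ [k]"
  obtains "y = v" "k = i + length v"
  | v' where "y = v' @ [k]" "insert_gen i v' = v"
  using assms
proof (induction y arbitrary: i v thesis)
  case Nil
  then show ?case by auto
next
  case (Cons a y)
  show ?case
  proof (cases "a < i")
    case True
    have "insert_gen (Suc i) y \<noteq> []"
      by (cases y) auto
    then obtain v1 where v: "v = a # v1" and *: "insert_gen (Suc i) y = v1 @ [k]"
      using Cons.prems(3) True by (cases v) auto
    show ?thesis
      using * by (rule Cons.IH[rotated 2]) (use v True Cons.prems in auto)
  next
    case False
    then have *: "i # a # y = v @ [k]"
      using Cons.prems(3) by simp
    then obtain v1 where v: "v = i # v1" "a # y = v1 @ [k]"
      by (cases v) auto
    have "insert_gen i v1 = v"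
      using v False by (cases v1) auto
    then show ?thesis
      using v Cons.prems(2) by auto
  qed
qed

text \<open>The effect of right multiplication by a generator on normal forms: the new letter moves to the
  left past all larger ones and increases each of them by 1. Nothing is lost in the process,
  which is why the semigroup is right cancellative.\<close>

fun append_gen :: "nat \<Rightarrow> nat list \<Rightarrow> nat list" where
  "append_gen m [] = [m]"
| "append_gen m (i # w) = (if i \<le> m then i # append_gen m w else m # map Suc (i # w))"

lemma insert_gen_map_Suc: "insert_gen (Suc i) (map Suc w) = map Suc (insert_gen i w)"
  by (induction w arbitrary: i) auto

text \<open>Left and right multiplication commute; as both agree on the empty word, \<open>append_gen\<close> computes
  right multiplication on every normal form.\<close>

lemma insert_append_gen: "insert_gen i (append_gen m w) = append_gen m (insert_gen i w)"
proof (induction w arbitrary: i)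
  case (Cons a w)
  then show ?case
    using insert_gen_map_Suc[of i "a # w"] by auto
qed auto

lemma append_gen_inj: "append_gen m u = append_gen m v \<Longrightarrow> u = v"
proof (induction u arbitrary: v)
  have nonempty: "append_gen m w \<noteq> []" "[] \<noteq> append_gen m w" for w
    by (cases w; auto)+
  {
    case Nil
    then show ?case
      using nonempty by (cases v) (auto split: if_splits)
  next
    have low: "append_gen m w \<noteq> Suc k # z" if "m < k" for w k z
      using that by (cases w) auto
    case (Cons a u)
    show ?case
    proof (cases v)
      case Nil
      then show ?thesis
        using nonempty Cons.prems by (auto split: if_splits)
    next
      case (Cons b w)
      then show ?thesis
        using Cons.prems Cons.IH[of w] low[of b u "map Suc w"] low[of a w "map Suc u"]
        by (auto split: if_splits)
    qed
  }
qed

lemma normal_form_times_gen [simp]: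
  "normal_form (s * gen m) = append_gen m (normal_form s)"
  by (induction s rule: thompson_induct) (auto simp: mult.assoc insert_append_gen)

lemma thompson_right_cancel:
  fixes s u v :: thompson
  assumes "u * s = v * s"
  shows "u = v"
  using assms
proof (induction s arbitrary: u v rule: thompson_induct)
  case (gen_times i s)
  then have "u * gen i = v * gen i"
    by (simp flip: mult.assoc)
  then have "append_gen i (normal_form u) = append_gen i (normal_form v)"
    by (metis normal_form_times_gen)
  then show ?case
    by (auto dest: append_gen_inj simp: normal_form_inject)
qed simp

lemma mem_append_gen: "m \<in> set (append_gen m w)"
  by (induction w) auto

lemma insert_gen_subset: "set (insert_gen i w) \<subseteq> set w \<union> {i..}"
proof (induction w arbitrary: i)
  case (Cons b w)
  have "set (insert_gen (Suc i) w) \<subseteq> set w \<union> {i..}"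
    using Cons.IH[of "Suc i"] by fastforce
  then show ?case
    by auto
qed auto

lemma sorted_insert_gen: "sorted w \<Longrightarrow> sorted (insert_gen i w)"
proof (induction w arbitrary: i)
  case (Cons a w)
  show ?case
  proof (cases "a < i")
    case True
    then show ?thesis
      using Cons.IH[of "Suc i"] Cons.prems insert_gen_subset[of "Suc i" w] by fastforce
  next
    case False
    then show ?thesis
      using Cons.prems by auto
  qed
qed simp

lemma sorted_normal_form: "sorted (normal_form s)"
  by (induction s rule: thompson_induct) (auto simp: sorted_insert_gen)

lemma normal_form_surj:
  assumes "sorted w"
  obtains s where "normal_form s = w"
proof -
  have "\<exists>s. normal_form s = w"
    using assms
  proof (induction w)
    case Nil
    then show ?case
      using normal_form_one by blast
  next
    case (Cons a w)
    then obtain s where "normal_form s = w"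
      by auto
    then have "normal_form (gen a * s) = a # w"
      using Cons.prems by (cases w) auto
    then show ?case
      by blast
  qed
  then show thesis
    using that by blast
qed

definition len :: "thompson \<Rightarrow> nat" where
  "len s = length (normal_form s)"

definition letters :: "thompson \<Rightarrow> nat set" where
  "letters s = set (normal_form s)"

lemma len_one [simp]: "len 1 = 0" and len_gen [simp]: "len (gen i) = 1"
  by (simp_all add: len_def)

lemma len_times [simp]: "len (s * t) = len s + len t"
proof (induction s rule: thompson_induct)
  case (gen_times i s)
  then show ?case
    by (simp add: len_def mult.assoc)
qed simp

lemma len_power [simp]: "len (s ^ n) = n * len s"
  by (induction n) auto

lemma len_eq_0_iff [simp]: "len s = 0 \<longleftrightarrow> s = 1"
  using normal_form_inject[of s 1] by (simp add: len_def)

lemma letters_gen [simp]: "letters (gen i) = {i}" and letters_one [simp]: "letters 1 = {}"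
  by (simp_all add: letters_def)

lemma len_eq_1E:
  assumes "len s = 1"
  obtains i where "s = gen i"
proof -
  obtain i where "normal_form s = [i]"
    using assms by (auto simp: len_def length_Suc_conv)
  then have "normal_form s = normal_form (gen i)"
    by simp
  then show thesis
    using that normal_form_inject by blast
qed

lemma gen_inject [simp]: "gen i = gen j \<longleftrightarrow> i = j"
  using normal_form_inject[of "gen i" "gen j"] by simp

text \<open>Passing a letter to the right through \<open>t\<close> changes the letter that moves but none of those of
  \<open>t\<close>. With the length bound this leaves finitely many right factors, hence finitely many
  factorizations.\<close>

lemma letters_right_factor: "letters t \<subseteq> letters (s * t)"
proof (induction s rule: thompson_induct)
  case (gen_times i s)
  then show ?case
    using subset_insert_gen[of "normal_form (s * t)" i] by (auto simp: letters_def mult.assoc)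
qed simp

lemma mem_letters_times_gen: "m \<in> letters (s * gen m)"
  by (simp add: letters_def mem_append_gen)

lemma finite_letters [simp]: "finite (letters s)"
  by (simp add: letters_def)

text \<open>The 0 only serves to give the unit, which has no letters, a bound.\<close>

definition bound :: "thompson \<Rightarrow> nat" where
  "bound s = Suc (Max (insert 0 (letters s)))"

lemma letters_less_bound: "k \<in> letters s \<Longrightarrow> bound s \<le> n \<Longrightarrow> k < n"
  unfolding bound_def using Max_ge[of "insert 0 (letters s)" k] finite_letters[of s]
  by (meson finite.insertI insertI2 le_less_trans less_eq_Suc_le)

lemma finite_right_factors: "finite {v. \<exists>u. u * v = (s :: thompson)}"
proof (rule finite_subset)
  show "finite (normal_form -` {w. set w \<subseteq> letters s \<and> length w \<le> len s})"
    by (intro finite_vimageI finite_lists_length_le) (auto simp: inj_def normal_form_inject)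
  have "set (normal_form v) \<subseteq> letters s \<and> length (normal_form v) \<le> len s" if "u * v = s" for u v
    unfolding that[symmetric] letters_def[of v, symmetric] len_def[of v, symmetric]
    by (simp add: letters_right_factor)
  then show "{v. \<exists>u. u * v = s} \<subseteq> normal_form -` {w. set w \<subseteq> letters s \<and> length w \<le> len s}"
    by blast
qed

section \<open>Division by generators of large index\<close>

text \<open>A generator beyond all letters of \<open>v\<close> passes all of them and becomes a recognisable last letter
  of the product. Tracing that letter back determines how the product can be divided.\<close>

lemma normal_form_large_gen_times:
  "\<forall>k\<in>letters v. k < n \<Longrightarrow> normal_form (gen n * v) = normal_form v @ [n + len v]"
  by (simp add: insert_gen_append letters_def len_def)

lemma letters_large_gen_times:
  assumes "\<forall>k\<in>letters v. k < n"
  shows "letters (gen n * v) = insert (n + len v) (letters v)"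
  using normal_form_large_gen_times[OF assms] by (auto simp: letters_def)

text \<open>Either the left factor is the large letter itself, or the large letter survives as the end of
  \<open>y\<close> and can be taken out of \<open>y\<close> on the left.\<close>

lemma gen_times_eq_large_gen_times:
  assumes "gen i * y = gen n * v" and "\<forall>k\<in>letters v. k < n"
  obtains "i = n" "y = v"
  | v' where "i < n" "y = gen (Suc n) * v'" "gen i * v' = v"
proof -
  have "insert_gen i (normal_form y) = normal_form v @ [n + len v]"
    using assms by (simp add: normal_form_large_gen_times flip: normal_form_gen_times)
  then show thesis
  proof (cases rule: insert_gen_eq_snoc)
    case 1
    then show ?thesis
      using that(1) by (simp add: normal_form_inject len_def)
  next
    case (2 z)
    have "sorted z"
      using sorted_normal_form[of y] 2(1) by (simp add: sorted_append)
    then obtain v' where z: "normal_form v' = z"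
      by (rule normal_form_surj)
    then have v: "gen i * v' = v"
      using 2(2) by (simp flip: normal_form_inject)
    have "\<exists>k\<in>letters v. i \<le> k"
      unfolding letters_def 2(2)[symmetric] by (rule insert_gen_ge)
    then have "i < n"
      using assms(2) by (meson le_less_trans)
    have "\<forall>k\<in>letters v'. k < Suc n"
      using letters_right_factor[of v' "gen i"] assms(2) unfolding v by (meson less_SucI subsetD)
    then have "normal_form (gen (Suc n) * v') = normal_form y"
      unfolding normal_form_large_gen_times[OF \<open>\<forall>k\<in>letters v'. k < Suc n\<close>] 2(1) z v[symmetric]
      by simp
    then show ?thesis
      using that(2) \<open>i < n\<close> v normal_form_inject by metis
  qed
qed

text \<open>The last letter of the product does not occur in \<open>u\<close>, and multiplication on the left preserves
  the letters of \<open>u\<close>, so it comes from a letter of \<open>w\<close> that passed everything to its right. Moved back to the front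
  of \<open>w\<close>, it is \<open>X\<^sub>n\<close>.\<close>

lemma large_gen_divides_left_factor:
  assumes "w * u = gen n * v" and "\<forall>k\<in>letters v. k < n" and "n + len v \<notin> letters u"
  obtains w' where "w = gen n * w'" "w' * u = v"
  using assms
proof (induction w arbitrary: n v thesis rule: thompson_induct)
  case one
  then show ?case
    using letters_large_gen_times[of v n] by simp
next
  case (gen_times a w)
  have "gen a * (w * u) = gen n * v"
    using gen_times.prems(2) by (simp add: mult.assoc)
  then show ?case
    using gen_times.prems(3)
  proof (cases rule: gen_times_eq_large_gen_times)
    case 1
    then show ?thesis
      using gen_times.prems(1)[of w] by simp
  next
    case (2 v')
    have "\<forall>k\<in>letters v'. k < Suc n"
      using letters_right_factor[of v' "gen a"] gen_times.prems(3) unfolding 2(3)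
      by (meson less_SucI subsetD)
    moreover have "Suc n + len v' \<notin> letters u"
      using gen_times.prems(4) by (simp flip: 2(3))
    ultimately obtain w' where w': "w = gen (Suc n) * w'" "w' * u = v'"
      using gen_times.IH 2(2) by blast
    have "gen a * w = gen n * (gen a * w')"
      using gen_relation[OF 2(1)] w'(1) by (simp flip: mult.assoc)
    moreover have "gen a * w' * u = v"
      using w'(2) 2(3) by (simp add: mult.assoc)
    ultimately show ?thesis
      using gen_times.prems(1) by blast
  qed
qed

section \<open>Completeness and density in the Hilbert space\<close>

lemma ell2_eqI: "(\<And>x. coord f x = coord g x) \<Longrightarrow> f = g"
  by (rule coord_inject[THEN iffD1], rule ext)

lemma has_sum_norm_ell2: "((\<lambda>x. (cmod (coord f x))\<^sup>2) has_sum (norm f)\<^sup>2) UNIV"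
  using coord[of f] by (simp add: norm_ell2 infsum_nonneg has_sum_infsum)

lemma sum_coord_le_norm:
  assumes "finite F"
  shows "(\<Sum>x\<in>F. (cmod (coord f x))\<^sup>2) \<le> (norm f)\<^sup>2"
  using assms by (intro has_sum_mono_neutral[OF has_sum_finite has_sum_norm_ell2]) auto

lemma norm_coord_le: "cmod (coord f x) \<le> norm f"
  using sum_coord_le_norm[of "{x}" f] by (simp add: power2_le_iff_abs_le)

text \<open>The way in which elements of \<open>\<ell>\<^sup>2\<close> are produced below: bounds on finite sets of coordinates give
  membership and the norm bound at once.\<close>

lemma square_summable_if_sums_bounded:
  assumes "\<And>F. finite F \<Longrightarrow> (\<Sum>x\<in>F. (cmod (\<phi> x))\<^sup>2) \<le> C\<^sup>2" and "0 \<le> C"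
  shows "coord (Abs_ell2 \<phi>) = \<phi>" and "norm (Abs_ell2 \<phi>) \<le> C"
proof -
  have "(\<lambda>x. (cmod (\<phi> x))\<^sup>2) summable_on UNIV"
    using assms by (intro nonneg_bdd_above_summable_on bdd_aboveI2[where M = "C\<^sup>2"]) auto
  then show *: "coord (Abs_ell2 \<phi>) = \<phi>"
    by (simp add: Abs_ell2_inverse)
  have "((\<lambda>x. (cmod (\<phi> x))\<^sup>2) has_sum (norm (Abs_ell2 \<phi>))\<^sup>2) UNIV"
    using has_sum_norm_ell2[of "Abs_ell2 \<phi>"] unfolding * .
  then have "(norm (Abs_ell2 \<phi>))\<^sup>2 \<le> C\<^sup>2"
    by (rule has_sum_le_finite_sums) (rule assms(1))
  then show "norm (Abs_ell2 \<phi>) \<le> C"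
    using assms(2) by (simp add: power2_le_iff_abs_le)
qed

text \<open>Completeness of \<open>\<ell>\<^sup>2\<close>: the coordinatewise limit of a Cauchy sequence is also its norm limit, since
  the estimates on finitely many coordinates pass to the limit.\<close>

instance ell2 :: (type) banach
proof
  fix f :: "nat \<Rightarrow> 'a ell2"
  assume "Cauchy f"
  have "Cauchy (\<lambda>n. coord (f n) x)" for x
  proof (rule metric_CauchyI)
    fix e :: real
    assume "0 < e"
    then obtain N where N: "\<And>m n. N \<le> m \<Longrightarrow> N \<le> n \<Longrightarrow> norm (f m - f n) < e"
      using \<open>Cauchy f\<close> unfolding Cauchy_def dist_norm by meson
    have "dist (coord (f m) x) (coord (f n) x) < e" if "N \<le> m" "N \<le> n" for m n
      using norm_coord_le[of "f m - f n" x] N[OF that]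
      by (simp add: dist_norm minus_ell2.rep_eq)
    then show "\<exists>M. \<forall>m\<ge>M. \<forall>n\<ge>M. dist (coord (f m) x) (coord (f n) x) < e"
      by blast
  qed
  then have "\<exists>l. (\<lambda>n. coord (f n) x) \<longlonglongrightarrow> l" for x
    using Cauchy_convergent convergent_def by blast
  then obtain \<phi> where \<phi>: "\<And>x. (\<lambda>n. coord (f n) x) \<longlonglongrightarrow> \<phi> x"
    by metis
  have tail: "\<exists>N. \<forall>m\<ge>N. coord (Abs_ell2 (\<lambda>x. coord (f m) x - \<phi> x)) = (\<lambda>x. coord (f m) x - \<phi> x)
      \<and> norm (Abs_ell2 (\<lambda>x. coord (f m) x - \<phi> x)) \<le> e" if "0 < e" for e
  proof -
    obtain N where N: "\<And>m n. N \<le> m \<Longrightarrow> N \<le> n \<Longrightarrow> norm (f m - f n) < e"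
      using \<open>Cauchy f\<close> \<open>0 < e\<close> unfolding Cauchy_def dist_norm by meson
    have "(\<Sum>x\<in>F. (cmod (coord (f m) x - \<phi> x))\<^sup>2) \<le> e\<^sup>2" if "N \<le> m" "finite F" for m F
    proof (rule tendsto_upperbound)
      show "(\<lambda>n. \<Sum>x\<in>F. (cmod (coord (f m) x - coord (f n) x))\<^sup>2)
          \<longlonglongrightarrow> (\<Sum>x\<in>F. (cmod (coord (f m) x - \<phi> x))\<^sup>2)"
        by (intro tendsto_intros \<phi>)
      have "(\<Sum>x\<in>F. (cmod (coord (f m) x - coord (f n) x))\<^sup>2) \<le> e\<^sup>2" if "N \<le> n" for n
      proof -
        have "(\<Sum>x\<in>F. (cmod (coord (f m) x - coord (f n) x))\<^sup>2) \<le> (norm (f m - f n))\<^sup>2"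
          using sum_coord_le_norm[OF \<open>finite F\<close>, of "f m - f n"] by (simp add: minus_ell2.rep_eq)
        also have "\<dots> \<le> e\<^sup>2"
          using N[OF \<open>N \<le> m\<close> that] by (intro power_mono) auto
        finally show ?thesis .
      qed
      then show "\<forall>\<^sub>F n in sequentially. (\<Sum>x\<in>F. (cmod (coord (f m) x - coord (f n) x))\<^sup>2) \<le> e\<^sup>2"
        unfolding eventually_sequentially by blast
    qed simp
    then show ?thesis
      using square_summable_if_sums_bounded[of "\<lambda>x. coord (f _) x - \<phi> x" e] \<open>0 < e\<close>
      by (intro exI[of _ N] allI impI conjI) auto
  qed
  obtain N where N: "coord (Abs_ell2 (\<lambda>x. coord (f N) x - \<phi> x)) = (\<lambda>x. coord (f N) x - \<phi> x)"
    using tail[of 1] by auto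
  define g where "g = f N - Abs_ell2 (\<lambda>x. coord (f N) x - \<phi> x)"
  have g: "coord g = \<phi>"
    by (auto simp: g_def minus_ell2.rep_eq N)
  have "f \<longlonglongrightarrow> g"
  proof (rule LIMSEQ_I)
    fix e :: real
    assume "0 < e"
    then obtain M where M: "\<And>m. M \<le> m \<Longrightarrow>
        coord (Abs_ell2 (\<lambda>x. coord (f m) x - \<phi> x)) = (\<lambda>x. coord (f m) x - \<phi> x)
        \<and> norm (Abs_ell2 (\<lambda>x. coord (f m) x - \<phi> x)) \<le> e / 2"
      using tail[of "e / 2"] by auto
    have "norm (f m - g) < e" if "M \<le> m" for m
    proof -
      have "f m - g = Abs_ell2 (\<lambda>x. coord (f m) x - \<phi> x)"
        by (rule ell2_eqI) (simp add: M[OF that] minus_ell2.rep_eq g)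
      then show ?thesis
        using M[OF that] \<open>0 < e\<close> by simp
    qed
    then show "\<exists>no. \<forall>n\<ge>no. norm (f n - g) < e"
      by blast
  qed
  then show "convergent f"
    by (rule convergentI)
qed

lift_definition restrict_ell2 :: "'a set \<Rightarrow> 'a ell2 \<Rightarrow> 'a ell2"
  is "\<lambda>X f x. if x \<in> X then f x else 0"
proof -
  fix X :: "'a set" and f :: "'a \<Rightarrow> complex"
  assume f: "(\<lambda>x. (cmod (f x))\<^sup>2) summable_on UNIV"
  show "(\<lambda>x. (cmod (if x \<in> X then f x else 0))\<^sup>2) summable_on UNIV"
    by (rule summable_on_comparison_test[OF f]) auto
qed

lemma norm_restrict_ell2_mono:
  assumes "X \<subseteq> Y"
  shows "norm (restrict_ell2 X f) \<le> norm (restrict_ell2 Y f)"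
proof -
  have "(norm (restrict_ell2 X f))\<^sup>2 \<le> (norm (restrict_ell2 Y f))\<^sup>2"
    by (rule has_sum_mono[OF has_sum_norm_ell2 has_sum_norm_ell2])
      (use assms in \<open>auto simp: restrict_ell2.rep_eq\<close>)
  then show ?thesis
    by (simp add: power2_le_iff_abs_le)
qed

lemma restrict_ell2_UNIV [simp]: "restrict_ell2 UNIV f = f"
  by (rule ell2_eqI) (simp add: restrict_ell2.rep_eq)

lemma norm_restrict_ell2_le: "norm (restrict_ell2 X f) \<le> norm f"
  using norm_restrict_ell2_mono[of X UNIV f] by simp

lemma bounded_linear_restrict_ell2: "bounded_linear (restrict_ell2 X)"
proof (rule bounded_linear_intro)
  show "restrict_ell2 X (f + g) = restrict_ell2 X f + restrict_ell2 X g"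
    "restrict_ell2 X (r *\<^sub>R f) = r *\<^sub>R restrict_ell2 X f" for f g :: "'a ell2" and r
    by (transfer; auto)+
  show "norm (restrict_ell2 X f) \<le> norm f * 1" for f :: "'a ell2"
    using norm_restrict_ell2_le by simp
qed

lemma norm_restrict_ell2_pythagoras:
  "(norm f)\<^sup>2 = (norm (restrict_ell2 X f))\<^sup>2 + (norm (f - restrict_ell2 X f))\<^sup>2"
proof -
  have "restrict_ell2 X f \<bullet> (f - restrict_ell2 X f) = 0"
    unfolding inner_ell2.rep_eq
    by (intro infsum_0) (auto simp: restrict_ell2.rep_eq minus_ell2.rep_eq)
  then show ?thesis
    using norm_add_Pythagorean[of "restrict_ell2 X f" "f - restrict_ell2 X f"]
    by (simp add: orthogonal_def)
qed

lemma norm_restrict_ell2_finite: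
  assumes "finite F"
  shows "(norm (restrict_ell2 F f))\<^sup>2 = (\<Sum>x\<in>F. (cmod (coord f x))\<^sup>2)"
proof -
  have "((\<lambda>x. (cmod (coord (restrict_ell2 F f) x))\<^sup>2) has_sum (\<Sum>x\<in>F. (cmod (coord f x))\<^sup>2)) UNIV"
    using has_sum_finite[OF assms, of "\<lambda>x. (cmod (coord f x))\<^sup>2"]
    by (rule has_sum_cong_neutral[THEN iffD1, rotated 3]) (auto simp: restrict_ell2.rep_eq)
  then show ?thesis
    using has_sum_norm_ell2 has_sum_unique by blast
qed

text \<open>The norm is the supremum of the norms of finite restrictions; this is the form in which the
  density of finitely supported functions is used.\<close>

lemma norm_restrict_ell2_approx:
  assumes "b < norm f"
  obtains F where "finite F" "b < norm (restrict_ell2 F f)"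
proof (cases "b < 0")
  case True
  then show ?thesis
    using that[of "{}"] by (meson finite.emptyI less_le_trans norm_ge_zero)
next
  case False
  then have "b\<^sup>2 < (norm f)\<^sup>2"
    using assms by (intro power_strict_mono) auto
  have "\<exists>F. finite F \<and> b\<^sup>2 < (norm (restrict_ell2 F f))\<^sup>2"
  proof (rule ccontr)
    assume "\<not> ?thesis"
    then have "(norm f)\<^sup>2 \<le> b\<^sup>2"
      using norm_restrict_ell2_finite[of _ f]
      by (intro has_sum_le_finite_sums[OF has_sum_norm_ell2]) (metis not_less)
    then show False
      using \<open>b\<^sup>2 < (norm f)\<^sup>2\<close> by simp
  qed
  then show ?thesis
    using that False by (meson norm_ge_zero not_less power_mono)
qed

lemma coord_sum: "coord (\<Sum>i\<in>I. f i) x = (\<Sum>i\<in>I. coord (f i) x)"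
  by (induction I rule: infinite_finite_induct) (auto simp: zero_ell2.rep_eq plus_ell2.rep_eq)

lemma restrict_ell2_finite:
  assumes "finite F"
  shows "restrict_ell2 F f = (\<Sum>u\<in>F. cscale (coord f u) (delta u))"
proof (rule ell2_eqI)
  fix x
  have "(\<Sum>u\<in>F. coord f u * (if x = u then 1 else 0)) = (if x \<in> F then coord f x else 0)"
    using assms by (simp add: if_distrib cong: if_cong)
  then show "coord (restrict_ell2 F f) x = coord (\<Sum>u\<in>F. cscale (coord f u) (delta u)) x"
    by (simp add: coord_sum restrict_ell2.rep_eq cscale.rep_eq delta.rep_eq)
qed

lemma bounded_ops_cscale: "A \<in> bounded_ops \<Longrightarrow> blinfun_apply A (cscale c f) = cscale c (blinfun_apply A f)"
  by (simp add: bounded_ops_def)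

lemma bounded_ops_restrict:
  assumes "A \<in> bounded_ops" "finite F"
  shows "blinfun_apply A (restrict_ell2 F f) = (\<Sum>u\<in>F. cscale (coord f u) (blinfun_apply A (delta u)))"
  using assms by (simp add: restrict_ell2_finite blinfun.sum_right bounded_ops_cscale)

lemma bounded_ops_eqI:
  assumes AB: "A \<in> bounded_ops" "B \<in> bounded_ops"
    and eq: "\<And>u. blinfun_apply A (delta u) = blinfun_apply B (delta u)"
  shows "A = B"
proof (rule blinfun_eqI)
  fix f
  let ?C = "A - B"
  have "norm (blinfun_apply ?C f) \<le> e" if "0 < e" for e
  proof -
    define d where "d = e / (1 + norm ?C)"
    have "0 < 1 + norm ?C"
      by (simp add: add_pos_nonneg)
    then have "0 < d"
      using \<open>0 < e\<close> by (simp add: d_def)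
    obtain F where F: "finite F" "(norm f)\<^sup>2 - d\<^sup>2 \<le> (norm (restrict_ell2 F f))\<^sup>2"
    proof (cases "d \<le> norm f")
      case True
      then have "sqrt ((norm f)\<^sup>2 - d\<^sup>2) < norm f"
        using \<open>0 < d\<close> by (intro real_less_lsqrt) auto
      then obtain F where "finite F" "sqrt ((norm f)\<^sup>2 - d\<^sup>2) < norm (restrict_ell2 F f)"
        by (rule norm_restrict_ell2_approx)
      then show ?thesis
        using that by (meson less_imp_le sqrt_le_D)
    next
      case False
      then have "(norm f)\<^sup>2 - d\<^sup>2 \<le> 0"
        using power_mono[of "norm f" d 2] by auto
      then show ?thesis
        using that[of "{}"] by (meson finite.emptyI order_trans zero_le_power2)
    qed
    then have "(norm (f - restrict_ell2 F f))\<^sup>2 \<le> d\<^sup>2"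
      using norm_restrict_ell2_pythagoras[of f F] by simp
    then have small: "norm (f - restrict_ell2 F f) \<le> d"
      using \<open>0 < d\<close> by (simp add: power2_le_iff_abs_le)
    have "blinfun_apply A (restrict_ell2 F f) = blinfun_apply B (restrict_ell2 F f)"
      by (simp add: bounded_ops_restrict AB F eq)
    then have "blinfun_apply ?C f = blinfun_apply ?C (f - restrict_ell2 F f)"
      by (simp add: blinfun.diff_left blinfun.diff_right)
    also have "norm \<dots> \<le> norm ?C * d"
      using norm_blinfun[of ?C] small by (meson mult_left_mono norm_ge_zero order_trans)
    also have "\<dots> \<le> (1 + norm ?C) * d"
      using \<open>0 < d\<close> by (intro mult_right_mono) auto
    also have "\<dots> = e"
      using \<open>0 < 1 + norm ?C\<close> by (simp add: d_def)
    finally show ?thesis .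
  qed
  then have "norm (blinfun_apply ?C f) \<le> 0"
    by (meson dense_ge)
  then show "blinfun_apply A f = blinfun_apply B f"
    by (simp add: blinfun.diff_left)
qed

lemma norm_delta [simp]: "norm (delta s :: 'a ell2) = 1"
proof -
  have "((\<lambda>x. (cmod (coord (delta s) x))\<^sup>2) has_sum 1) {s}"
    using has_sum_finite[of "{s}" "\<lambda>x. (cmod (coord (delta s) x))\<^sup>2"] by (simp add: delta.rep_eq)
  then have "((\<lambda>x. (cmod (coord (delta s) x))\<^sup>2) has_sum 1) UNIV"
    by (rule has_sum_cong_neutral[THEN iffD1, rotated 3]) (auto simp: delta.rep_eq)
  then have "(norm (delta s))\<^sup>2 = 1"
    using has_sum_norm_ell2 has_sum_unique by blast
  then show ?thesis
    by (simp add: power2_eq_1_iff) (smt (verit) norm_ge_zero)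
qed

section \<open>Left and right translations\<close>

lemma coord_left_translate_times [simp]:
  "coord (blinfun_apply (left_translate s) g) (s * v) = coord g v"
  using is_left_convolution_left_translate[of s]
  by (simp add: is_left_convolution_def convolution_delta_translate)

lemma coord_left_translate_outside:
  "t \<notin> range ((*) s) \<Longrightarrow> coord (blinfun_apply (left_translate s) g) t = 0"
  using is_left_convolution_left_translate[of s]
  by (simp add: is_left_convolution_def convolution_delta_outside)

lemma norm_left_translate_apply: "norm (blinfun_apply (left_translate s) g) = norm g"
proof -
  have "((\<lambda>t. (cmod (coord (blinfun_apply (left_translate s) g) t))\<^sup>2) has_sum (norm g)\<^sup>2) UNIV"
    using convolution_delta_has_sum[of s g] is_left_convolution_left_translate[of s]
    by (simp add: is_left_convolution_def)
  then have "(norm (blinfun_apply (left_translate s) g))\<^sup>2 = (norm g)\<^sup>2"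
    using has_sum_norm_ell2 has_sum_unique by blast
  then show ?thesis
    by simp
qed

lemma norm_left_translate_le: "norm (left_translate s) \<le> 1"
  by (rule norm_blinfun_bound) (auto simp: norm_left_translate_apply)

text \<open>Both operators move the coordinate at \<open>v\<close> to \<open>s t v\<close>; the case distinctions check that they vanish
  at the elements that are not of this form.\<close>

lemma left_translate_mult: "left_translate (s * t) = left_translate s o\<^sub>L left_translate t"
proof (rule blinfun_eqI, rule ell2_eqI)
  fix g x
  show "coord (blinfun_apply (left_translate (s * t)) g) x
      = coord (blinfun_apply (left_translate s o\<^sub>L left_translate t) g) x"
  proof (cases "x \<in> range ((*) (s * t))")
    case True
    then show ?thesis
      by (auto simp: mult.assoc) (simp flip: mult.assoc)
  next
    case False
    have "coord (blinfun_apply (left_translate s) (blinfun_apply (left_translate t) g)) x = 0"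
    proof (cases "x \<in> range ((*) s)")
      case True
      then obtain y where y: "x = s * y"
        by blast
      then have "y \<notin> range ((*) t)"
        using False by (auto simp: mult.assoc)
      then show ?thesis
        by (simp add: y coord_left_translate_outside)
    qed (simp add: coord_left_translate_outside)
    with False show ?thesis
      by (simp add: coord_left_translate_outside)
  qed
qed

lemma left_translate_one: "left_translate 1 = id_blinfun"
  by (rule blinfun_eqI, rule ell2_eqI) (metis coord_left_translate_times id_blinfun.rep_eq id_apply mult_1)

lemma left_translate_delta: "blinfun_apply (left_translate s) (delta t) = delta (s * t)"
proof (rule ell2_eqI)
  fix x
  show "coord (blinfun_apply (left_translate s) (delta t)) x = coord (delta (s * t)) x"
    by (cases "x \<in> range ((*) s)")
      (auto simp: coord_left_translate_outside delta.rep_eq dest: thompson_left_cancel)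
qed

definition right_translate :: "thompson \<Rightarrow> thompson ell2 \<Rightarrow> thompson ell2" where
  "right_translate s g =
    Abs_ell2 (\<lambda>t. if \<exists>v. t = v * s then coord g (THE v. t = v * s) else 0)"

lemma coord_right_translate:
  "coord (right_translate s g) = (\<lambda>t. if \<exists>v. t = v * s then coord g (THE v. t = v * s) else 0)"
proof -
  let ?h = "\<lambda>t. if \<exists>v. t = v * s then coord g (THE v. t = v * s) else 0"
  have "(THE v'. v * s = v' * s) = v" for v
    by (rule the_equality) (auto dest: thompson_right_cancel)
  then have h: "?h (v * s) = coord g v" for v
    by auto
  have "(\<lambda>x. (cmod (coord g x))\<^sup>2) summable_on UNIV"
    using coord[of g] by simp
  then have "((\<lambda>x. (cmod (?h x))\<^sup>2) \<circ> (\<lambda>v. v * s)) summable_on UNIV"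
    by (simp add: o_def h)
  moreover have "inj (\<lambda>v. v * s)"
    by (rule injI) (rule thompson_right_cancel)
  ultimately have "(\<lambda>x. (cmod (?h x))\<^sup>2) summable_on range (\<lambda>v. v * s)"
    by (simp add: summable_on_reindex)
  then have "(\<lambda>x. (cmod (?h x))\<^sup>2) summable_on UNIV"
    by (rule summable_on_cong_neutral[THEN iffD1, rotated 3]) auto
  then show ?thesis
    unfolding right_translate_def by (intro Abs_ell2_inverse) simp
qed

lemma coord_right_translate_times [simp]: "coord (right_translate s g) (v * s) = coord g v"
proof -
  have "(THE v'. v * s = v' * s) = v"
    by (rule the_equality) (auto dest: thompson_right_cancel)
  then show ?thesis
    by (auto simp: coord_right_translate)
qed

lemma coord_right_translate_outside:
  "(\<And>v. t \<noteq> v * s) \<Longrightarrow> coord (right_translate s g) t = 0"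
  by (simp add: coord_right_translate)

lemma norm_right_translate: "norm (right_translate s g) = norm g"
proof -
  let ?h = "\<lambda>t. (cmod (coord (right_translate s g) t))\<^sup>2"
  have "((?h \<circ> (\<lambda>v. v * s)) has_sum (norm g)\<^sup>2) UNIV"
    using has_sum_norm_ell2[of g] by (simp add: o_def)
  moreover have "inj (\<lambda>v. v * s)"
    by (rule injI) (rule thompson_right_cancel)
  ultimately have "(?h has_sum (norm g)\<^sup>2) (range (\<lambda>v. v * s))"
    by (simp add: has_sum_reindex)
  then have "(?h has_sum (norm g)\<^sup>2) UNIV"
    by (rule has_sum_cong_neutral[THEN iffD1, rotated 3])
      (auto intro!: coord_right_translate_outside)
  then have "(norm (right_translate s g))\<^sup>2 = (norm g)\<^sup>2"
    using has_sum_norm_ell2 has_sum_unique by blast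
  then show ?thesis
    by simp
qed

lemma bounded_linear_right_translate: "bounded_linear (right_translate s)"
proof (rule bounded_linear_intro)
  show "right_translate s (f + g) = right_translate s f + right_translate s g"
    "right_translate s (r *\<^sub>R f) = r *\<^sub>R right_translate s f" for f g r
    by (rule ell2_eqI, simp add: coord_right_translate plus_ell2.rep_eq scaleR_ell2.rep_eq)+
  show "norm (right_translate s f) \<le> norm f * 1" for f
    by (simp add: norm_right_translate)
qed

lemma right_translate_cscale: "right_translate s (cscale c f) = cscale c (right_translate s f)"
  by (rule ell2_eqI) (simp add: coord_right_translate cscale.rep_eq)

lemma right_translate_delta: "right_translate s (delta t) = delta (t * s)"
proof (rule ell2_eqI)
  fix x
  show "coord (right_translate s (delta t)) x = coord (delta (t * s)) x"
    by (cases "\<exists>v. x = v * s")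
      (auto simp: coord_right_translate_outside delta.rep_eq dest: thompson_right_cancel)
qed

lemma right_translate_mult: "right_translate (u * s) g = right_translate s (right_translate u g)"
proof (rule ell2_eqI)
  fix x
  show "coord (right_translate (u * s) g) x = coord (right_translate s (right_translate u g)) x"
  proof (cases "\<exists>v. x = v * (u * s)")
    case True
    then obtain v where x: "x = v * (u * s)"
      by blast
    have "coord (right_translate s (right_translate u g)) ((v * u) * s) = coord g v"
      by (simp only: coord_right_translate_times)
    then show ?thesis
      by (simp add: x mult.assoc)
  next
    case False
    have "coord (right_translate s (right_translate u g)) x = 0"
    proof (cases "\<exists>y. x = y * s")
      case True
      then obtain y where y: "x = y * s"
        by blast
      then have "y \<noteq> v * u" for v
        using False by (auto simp: mult.assoc)
      then show ?thesis
        by (simp add: y coord_right_translate_outside)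
    qed (simp add: coord_right_translate_outside)
    with False show ?thesis
      by (simp add: coord_right_translate_outside)
  qed
qed

text \<open>A closed subalgebra containing all \<open>L\<^sub>s\<close>, hence an upper bound for the Banach algebra. It
  replaces the algebra of left convolution operators, whose closure properties are harder to
  see: its members are determined by their value at \<open>\<delta>\<^sub>1\<close>.\<close>

definition right_commutant :: "(thompson ell2 \<Rightarrow>\<^sub>L thompson ell2) set" where
  "right_commutant = {A \<in> bounded_ops.
    \<forall>s g. blinfun_apply A (right_translate s g) = right_translate s (blinfun_apply A g)}"

lemma left_translate_in_right_commutant: "left_translate s \<in> right_commutant"
proof -
  have "coord (blinfun_apply (left_translate s) (right_translate u g)) t
      = coord (right_translate u (blinfun_apply (left_translate s) g)) t" for u g t
  proof (cases "\<exists>v. t = s * v * u")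
    case True
    then obtain v where v: "t = s * v * u"
      by blast
    have "coord (blinfun_apply (left_translate s) (right_translate u g)) (s * (v * u)) = coord g v"
      "coord (right_translate u (blinfun_apply (left_translate s) g)) ((s * v) * u) = coord g v"
      by (simp_all only: coord_left_translate_times coord_right_translate_times)
    then show ?thesis
      by (simp add: v mult.assoc)
  next
    case False
    have "coord (blinfun_apply (left_translate s) (right_translate u g)) t = 0"
    proof (cases "t \<in> range ((*) s)")
      case True
      then show ?thesis
        using False by (auto simp: mult.assoc intro!: coord_right_translate_outside)
    qed (simp add: coord_left_translate_outside)
    moreover have "coord (right_translate u (blinfun_apply (left_translate s) g)) t = 0"
    proof (cases "\<exists>v. t = v * u")
      case True
      then show ?thesis
        using False by (auto intro!: coord_left_translate_outside)
    qed (simp add: coord_right_translate_outside)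
    ultimately show ?thesis
      by simp
  qed
  then show ?thesis
    by (simp add: right_commutant_def left_translate_in_bounded_ops ell2_eqI)
qed

lemma subalgebra_right_commutant: "subalgebra right_commutant"
  using subalgebra_bounded_ops bounded_linear_right_translate
  unfolding subalgebra_def right_commutant_def
  by (auto simp: blinfun.add_left right_translate_cscale linear_simps)

lemma closed_right_commutant: "closed right_commutant"
proof -
  have eq: "right_commutant = bounded_ops \<inter> (\<Inter>s. \<Inter>g. {A. blinfun_apply A (right_translate s g)
      = right_translate s (blinfun_apply A g)})"
    by (auto simp: right_commutant_def)
  show ?thesis
    unfolding eq
    by (intro closed_Int closed_bounded_ops closed_INT ballI closed_Collect_eq
        blinfun.continuous_on bounded_linear.continuous_on[OF bounded_linear_right_translate]
        continuous_intros)
qed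

lemma right_commutant_apply_delta:
  assumes "A \<in> right_commutant"
  shows "blinfun_apply A (delta s) = right_translate s (blinfun_apply A (delta 1))"
proof -
  have "blinfun_apply A (right_translate s (delta 1)) = right_translate s (blinfun_apply A (delta 1))"
    using assms by (simp add: right_commutant_def)
  then show ?thesis
    by (simp add: right_translate_delta)
qed

lemma subalgebra_thompson: "subalgebra thompson_banach_algebra"
  and closed_thompson: "closed thompson_banach_algebra"
  and left_translate_mem: "left_translate s \<in> thompson_banach_algebra"
  using banach_algebra_generated[of "range left_translate"] left_translate_in_bounded_ops
  by (auto simp: thompson_banach_algebra_def)

lemma thompson_banach_algebra_minimal:
  assumes "subalgebra A" "closed A" "range left_translate \<subseteq> A"
  shows "thompson_banach_algebra \<subseteq> A"
  unfolding thompson_banach_algebra_def banach_algebra_generated_def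
  using assms by (intro hull_minimal) auto

lemma thompson_subset_right_commutant: "thompson_banach_algebra \<subseteq> right_commutant"
  using thompson_banach_algebra_minimal subalgebra_right_commutant closed_right_commutant
    left_translate_in_right_commutant by blast

section \<open>Convolution as a finite sum\<close>

definition factorizations :: "thompson \<Rightarrow> (thompson \<times> thompson) set" where
  "factorizations s = {(u, v). u * v = s}"

lemma inj_on_snd_factorizations: "inj_on snd (factorizations s)"
  by (auto simp: inj_on_def factorizations_def dest: thompson_right_cancel)

lemma finite_factorizations: "finite (factorizations s)"
proof (rule finite_imageD[OF _ inj_on_snd_factorizations])
  show "finite (snd ` factorizations s)"
    by (rule finite_subset[OF _ finite_right_factors[of s]]) (auto simp: factorizations_def)
qed

lemma convolution_eq_sum: "convolution f g s = (\<Sum>(u, v)\<in>factorizations s. f u * g v)"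
  unfolding convolution_def factorizations_def[symmetric] using finite_factorizations
  by (rule infsum_finite)

lemma convolution_delta_right: "convolution f (coord (delta s)) (v * s) = f v"
proof -
  have "convolution f (coord (delta s)) (v * s) = (\<Sum>\<^sub>\<infinity>(u, w)\<in>{(v, s)}. f u * coord (delta s) w)"
    unfolding convolution_def
    by (rule infsum_cong_neutral) (auto simp: delta.rep_eq split: if_splits dest: thompson_right_cancel)
  then show ?thesis
    by (simp add: delta.rep_eq)
qed

lemma convolution_delta_right_outside:
  assumes "\<And>v. t \<noteq> v * s"
  shows "convolution f (coord (delta s)) t = 0"
  unfolding convolution_def
  by (intro infsum_0) (use assms in \<open>force simp: delta.rep_eq\<close>)

lemma left_convolution_apply_delta:
  assumes "is_left_convolution f T"
  shows "blinfun_apply T (delta s) = right_translate s f"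
proof (rule ell2_eqI)
  fix t
  show "coord (blinfun_apply T (delta s)) t = coord (right_translate s f) t"
    using assms by (cases "\<exists>v. t = v * s")
      (auto simp: is_left_convolution_def convolution_delta_right convolution_delta_right_outside
        coord_right_translate_outside)
qed

section \<open>Automatic continuity of derivations\<close>

definition length_cutoff :: "nat \<Rightarrow> (thompson ell2 \<Rightarrow>\<^sub>L thompson ell2)" where
  "length_cutoff m = Blinfun (restrict_ell2 {t. len t < m})"

lemma length_cutoff_apply: "blinfun_apply (length_cutoff m) f = restrict_ell2 {t. len t < m} f"
  by (simp add: length_cutoff_def bounded_linear_Blinfun_apply bounded_linear_restrict_ell2)

lemma norm_length_cutoff_le: "norm (length_cutoff m) \<le> 1"
  by (rule norm_blinfun_bound) (auto simp: length_cutoff_apply norm_restrict_ell2_le)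

text \<open>Left translation by \<open>s\<close> raises lengths by exactly the length of \<open>s\<close>. For \<open>m = 0\<close> this says that
  nothing of \<open>L\<^sub>s g\<close> is visible below the length of \<open>s\<close>.\<close>

lemma length_cutoff_left_translate:
  "length_cutoff (len s + m) o\<^sub>L left_translate s = left_translate s o\<^sub>L length_cutoff m"
proof (rule blinfun_eqI, rule ell2_eqI)
  fix g t
  show "coord (blinfun_apply (length_cutoff (len s + m) o\<^sub>L left_translate s) g) t
      = coord (blinfun_apply (left_translate s o\<^sub>L length_cutoff m) g) t"
    by (cases "t \<in> range ((*) s)")
      (auto simp: length_cutoff_apply restrict_ell2.rep_eq coord_left_translate_outside)
qed

lemma length_cutoff_0 [simp]: "length_cutoff 0 = 0"
  by (rule blinfun_eqI, rule ell2_eqI)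
    (simp add: length_cutoff_apply restrict_ell2.rep_eq zero_ell2.rep_eq)

lemma norm_left_translate_compose: "norm (left_translate s o\<^sub>L A) = norm A"
proof (rule antisym)
  have "norm (left_translate s o\<^sub>L A) \<le> norm (left_translate s) * norm A"
    by (rule norm_blinfun_compose)
  also have "\<dots> \<le> 1 * norm A"
    by (intro mult_right_mono norm_left_translate_le norm_ge_zero)
  finally show "norm (left_translate s o\<^sub>L A) \<le> norm A"
    by simp
  show "norm A \<le> norm (left_translate s o\<^sub>L A)"
  proof (rule norm_blinfun_bound)
    show "norm (blinfun_apply A f) \<le> norm (left_translate s o\<^sub>L A) * norm f" for f
      using norm_blinfun[of "left_translate s o\<^sub>L A" f] by (simp add: norm_left_translate_apply)
  qed simp
qed

lemma norm_length_cutoff_approx: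
  assumes "0 \<le> b" "b < norm A"
  obtains m where "b < norm (length_cutoff m o\<^sub>L A)"
proof -
  obtain g where g: "b * norm g < norm (blinfun_apply A g)"
    using norm_blinfun_bound[of b A] assms by (meson not_le)
  then obtain F where F: "finite F" "b * norm g < norm (restrict_ell2 F (blinfun_apply A g))"
    by (rule norm_restrict_ell2_approx)
  define m where "m = Suc (Max (insert 0 (len ` F)))"
  have "F \<subseteq> {t. len t < m}"
    using F(1) by (auto simp: m_def less_Suc_eq_le)
  then have "b * norm g < norm (blinfun_apply (length_cutoff m o\<^sub>L A) g)"
    using F(2) norm_restrict_ell2_mono[of F "{t. len t < m}" "blinfun_apply A g"]
    by (simp add: length_cutoff_apply)
  also have "\<dots> \<le> norm (length_cutoff m o\<^sub>L A) * norm g"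
    by (rule norm_blinfun)
  finally have "b < norm (length_cutoff m o\<^sub>L A)"
    by (simp add: mult_less_cancel_right)
  then show thesis
    by (rule that)
qed

lemma scale_op_of_real: "scale_op (of_real r) A = r *\<^sub>R A"
proof (rule blinfun_eqI)
  have "cscale (of_real r) f = r *\<^sub>R f" for f :: "'a ell2"
    by (rule ell2_eqI) (simp add: cscale.rep_eq scaleR_ell2.rep_eq)
  then show "blinfun_apply (scale_op (of_real r) A) f = blinfun_apply (r *\<^sub>R A) f" for f
    by (simp add: blinfun.scaleR_left)
qed

lemma subalgebra_scaleR: "subalgebra \<A> \<Longrightarrow> A \<in> \<A> \<Longrightarrow> r *\<^sub>R A \<in> \<A>"
  unfolding subalgebra_def by (simp flip: scale_op_of_real)

lemma subalgebra_diff: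
  assumes "subalgebra \<A>" "A \<in> \<A>" "B \<in> \<A>"
  shows "A - B \<in> \<A>"
proof -
  have "A + (-1) *\<^sub>R B \<in> \<A>"
    using assms subalgebra_scaleR[of \<A> B "-1"] unfolding subalgebra_def by blast
  then show ?thesis
    by simp
qed

lemma thompson_closed_under:
  shows "0 \<in> thompson_banach_algebra"
    "A \<in> thompson_banach_algebra \<Longrightarrow> B \<in> thompson_banach_algebra \<Longrightarrow> A + B \<in> thompson_banach_algebra"
    "A \<in> thompson_banach_algebra \<Longrightarrow> B \<in> thompson_banach_algebra \<Longrightarrow> A o\<^sub>L B \<in> thompson_banach_algebra"
  using subalgebra_thompson unfolding subalgebra_def by auto

lemma thompson_suminf:
  assumes "summable f" "\<And>i. f i \<in> thompson_banach_algebra"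
  shows "suminf f \<in> thompson_banach_algebra"
proof -
  have "(\<Sum>i<n. f i) \<in> thompson_banach_algebra" for n
    by (induction n) (auto simp: assms(2) thompson_closed_under)
  then show ?thesis
    by (intro closed_sequentially[OF closed_thompson _ summable_LIMSEQ[OF assms(1)]]) auto
qed

lemma blinfun_compose_assoc: "(A o\<^sub>L B) o\<^sub>L C = A o\<^sub>L (B o\<^sub>L C)"
  by (rule blinfun_eqI) simp

locale thompson_derivation =
  fixes D :: "(thompson ell2 \<Rightarrow>\<^sub>L thompson ell2) \<Rightarrow> (thompson ell2 \<Rightarrow>\<^sub>L thompson ell2)"
  assumes derivation: "derivation_on thompson_banach_algebra D"
begin

lemma D_mem: "A \<in> thompson_banach_algebra \<Longrightarrow> D A \<in> thompson_banach_algebra"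
  and D_add: "A \<in> thompson_banach_algebra \<Longrightarrow> B \<in> thompson_banach_algebra \<Longrightarrow> D (A + B) = D A + D B"
  and D_scale: "A \<in> thompson_banach_algebra \<Longrightarrow> D (scale_op c A) = scale_op c (D A)"
  and D_mult: "A \<in> thompson_banach_algebra \<Longrightarrow> B \<in> thompson_banach_algebra
    \<Longrightarrow> D (A o\<^sub>L B) = (A o\<^sub>L D B) + (D A o\<^sub>L B)"
  using derivation unfolding derivation_on_def by auto

lemma D_scaleR: "A \<in> thompson_banach_algebra \<Longrightarrow> D (r *\<^sub>R A) = r *\<^sub>R D A"
  using D_scale[of A "of_real r"] by (simp add: scale_op_of_real)

lemma D_zero: "D 0 = 0"
  using D_scaleR[of 0 0] by (simp add: thompson_closed_under)

lemma D_left_translate_one: "D (left_translate 1) = 0"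
proof -
  have "left_translate 1 o\<^sub>L A = A" "A o\<^sub>L left_translate 1 = A" for A
    by (auto intro: blinfun_eqI simp: left_translate_one)
  then show ?thesis
    using D_mult[of "left_translate 1" "left_translate 1"] left_translate_mem[of 1] by simp
qed

text \<open>Linear growth suffices: it gives control over the derivatives of the shifts before the shifts
  are chosen.\<close>

lemma norm_D_left_translate_power: "norm (D (left_translate (s ^ n))) \<le> n * norm (D (left_translate s))"
proof (induction n)
  case 0
  then show ?case
    by (simp add: D_left_translate_one)
next
  case (Suc n)
  have "D (left_translate (s ^ Suc n)) = (left_translate s o\<^sub>L D (left_translate (s ^ n)))
      + (D (left_translate s) o\<^sub>L left_translate (s ^ n))"
    by (simp add: left_translate_mult D_mult left_translate_mem)
  also have "norm \<dots> \<le> norm (D (left_translate (s ^ n))) + norm (D (left_translate s)) * 1"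
  proof (intro norm_triangle_mono)
    show "norm (D (left_translate s) o\<^sub>L left_translate (s ^ n)) \<le> norm (D (left_translate s)) * 1"
      using norm_blinfun_compose[of "D (left_translate s)" "left_translate (s ^ n)"]
        norm_left_translate_le[of "s ^ n"]
      by (meson mult_left_mono norm_ge_zero order_trans)
  qed (simp add: norm_left_translate_compose)
  finally show ?case
    using Suc by (simp add: algebra_simps)
qed

text \<open>The gliding hump. If \<open>D\<close> is unbounded, one chooses inductively shifts \<open>N j\<close> and operators \<open>a j\<close> so
  small that \<open>C 0 = (\<Sum>j. W (N j) a j)\<close> converges, with \<open>D (a j)\<close> so large, already below
  length \<open>k j = N (j + 1) - N j\<close>, that it dominates everything chosen before. Below
  length \<open>N (j + 1)\<close> the derivation rule leaves of \<open>D (C 0)\<close> only \<open>W (N j) D (a j)\<close>, the derivative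
  of the earlier terms, and two terms of bounded norm in which \<open>D\<close> falls on a shift.\<close>

lemma D_bounded: "\<exists>K. \<forall>A\<in>thompson_banach_algebra. norm (D A) \<le> K * norm A"
proof (rule ccontr)
  assume unbounded: "\<not> ?thesis"
  have big: "\<exists>A\<in>thompson_banach_algebra. norm A \<le> \<epsilon> \<and> b < norm (D A)" if "0 < \<epsilon>" for \<epsilon> b
  proof -
    obtain A where A: "A \<in> thompson_banach_algebra" "\<bar>b\<bar> / \<epsilon> * norm A < norm (D A)"
      using unbounded by (meson not_le)
    then have "A \<noteq> 0"
      using D_zero by auto
    let ?r = "\<epsilon> / norm A"
    have "0 < ?r"
      using \<open>0 < \<epsilon>\<close> \<open>A \<noteq> 0\<close> by simp
    have "norm (?r *\<^sub>R A) \<le> \<epsilon>"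
      using \<open>0 < \<epsilon>\<close> \<open>A \<noteq> 0\<close> by simp
    moreover have "b < norm (D (?r *\<^sub>R A))"
    proof -
      have "b \<le> ?r * (\<bar>b\<bar> / \<epsilon> * norm A)"
        using \<open>0 < \<epsilon>\<close> \<open>A \<noteq> 0\<close> by simp
      also have "\<dots> < ?r * norm (D A)"
        using A(2) \<open>0 < ?r\<close> by (rule mult_strict_left_mono)
      also have "\<dots> = norm (D (?r *\<^sub>R A))"
        using \<open>0 < \<epsilon>\<close> by (simp add: D_scaleR[OF A(1)])
      finally show ?thesis .
    qed
    ultimately show ?thesis
      using subalgebra_scaleR[OF subalgebra_thompson A(1)] by blast
  qed
  \<comment> \<open>Any isometry \<open>L\<^sub>s\<close> with \<open>s \<noteq> 1\<close> pushes supports to large length under iteration; \<open>X\<^sub>0\<close> is a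
    convenient choice.\<close>
  define W where "W n = left_translate (gen 0 ^ n)" for n
  define d where "d = norm (D (left_translate (gen 0)))"
  have W_mem: "W n \<in> thompson_banach_algebra" for n
    by (simp add: W_def left_translate_mem)
  have W_add: "W (m + n) = W m o\<^sub>L W n" for m n
    by (simp add: W_def power_add left_translate_mult)
  have norm_W: "norm (W n o\<^sub>L A) = norm A" for n A
    by (simp add: W_def norm_left_translate_compose)
  have norm_DW: "norm (D (W n)) \<le> n * d" for n
    unfolding W_def d_def by (rule norm_D_left_translate_power)
  have cutoff_W: "length_cutoff (n + m) o\<^sub>L W n = W n o\<^sub>L length_cutoff m" for m n
    using length_cutoff_left_translate[of "gen 0 ^ n" m] by (simp add: W_def)
  have "0 \<le> d"
    by (simp add: d_def)
  \<comment> \<open>The factor \<open>1 + n d\<close> compensates the norm of \<open>D (W n)\<close>; the margin \<open>j + 4\<close> is what contradicts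
    a finite norm of \<open>D (C 0)\<close> in the end, where 3 of the 4 absorb error terms.\<close>
  have "\<exists>A m. A \<in> thompson_banach_algebra \<and> norm A * (1 + n * d) \<le> (1/2) ^ j
      \<and> real j + 4 + norm (D S) < norm (length_cutoff m o\<^sub>L D A)" for j n :: nat and S
  proof -
    have pos: "0 < 1 + n * d"
      using \<open>0 \<le> d\<close> by (simp add: add_pos_nonneg)
    then obtain A where A: "A \<in> thompson_banach_algebra" "norm A \<le> (1/2) ^ j / (1 + n * d)"
      "real j + 4 + norm (D S) < norm (D A)"
      using big[of "(1/2) ^ j / (1 + n * d)" "real j + 4 + norm (D S)"] by auto
    obtain m where "real j + 4 + norm (D S) < norm (length_cutoff m o\<^sub>L D A)"
      using norm_length_cutoff_approx[OF _ A(3)] by (auto simp: add_nonneg_nonneg)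
    then show ?thesis
      using A pos by (auto simp: pos_le_divide_eq)
  qed
  then have "\<forall>j (n :: nat) S. \<exists>A m. A \<in> thompson_banach_algebra \<and> norm A * (1 + n * d) \<le> (1/2) ^ j
      \<and> real j + 4 + norm (D S) < norm (length_cutoff m o\<^sub>L D A)"
    by blast
  then obtain A m where A_mem: "\<And>j n S. A j n S \<in> thompson_banach_algebra"
    and A_small: "\<And>j n S. norm (A j n S) * (1 + real n * d) \<le> (1/2) ^ j"
    and DA_big: "\<And>j n S. real j + 4 + norm (D S) < norm (length_cutoff (m j n S) o\<^sub>L D (A j n S))"
    unfolding choice_iff by blast
  \<comment> \<open>The state consists of the current shift and of the partial sum, whose derivative has to be
    dominated by the next term.\<close>
  define st where "st = rec_nat (0, 0) (\<lambda>j (n, S). (n + m j n S, S + (W n o\<^sub>L A j n S)))"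
  define N where "N j = fst (st j)" for j
  define S where "S j = snd (st j)" for j
  define a where "a j = A j (N j) (S j)" for j
  define k where "k j = m j (N j) (S j)" for j
  have N_0: "N 0 = 0" and S_0: "S 0 = 0"
    by (simp_all add: N_def S_def st_def)
  have N_Suc: "N (Suc j) = N j + k j" and S_Suc: "S (Suc j) = S j + (W (N j) o\<^sub>L a j)" for j
    by (simp_all add: N_def S_def st_def a_def k_def split: prod.split)
  have N_mono: "N i \<le> N (j + i)" for i j
    by (induction j) (auto simp: N_Suc)
  have a_mem: "a j \<in> thompson_banach_algebra" for j
    by (simp add: a_def A_mem)
  have a_small: "norm (a j) * (1 + N j * d) \<le> (1/2) ^ j" for j
    by (simp add: a_def A_small)
  have S_mem: "S j \<in> thompson_banach_algebra" for j
    by (induction j) (auto simp: S_0 S_Suc thompson_closed_under W_mem a_mem)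
  have S_sum: "S j = (\<Sum>i<j. W (N i) o\<^sub>L a i)" for j
    by (induction j) (auto simp: S_0 S_Suc)
  \<comment> \<open>\<open>C j\<close> below is the tail of the series from \<open>j\<close> on with the common shift \<open>W (N j)\<close> taken out.\<close>
  define c where "c j i = W (N (i + j) - N j) o\<^sub>L a (i + j)" for i j
  have norm_c: "norm (c j i) * (1 + N j * d) \<le> (1/2) ^ i" for i j
  proof -
    have "norm (c j i) * (1 + N j * d) \<le> norm (a (i + j)) * (1 + N (i + j) * d)"
      using N_mono[of j i] \<open>0 \<le> d\<close> by (simp add: c_def norm_W mult_left_mono mult_right_mono)
    also have "\<dots> \<le> (1/2) ^ (i + j)"
      by (rule a_small)
    also have "\<dots> \<le> (1/2) ^ i"
      by (rule power_decreasing) auto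
    finally show ?thesis .
  qed
  have "norm (c j i) \<le> (1/2) ^ i" for i j
  proof -
    have "norm (c j i) * 1 \<le> norm (c j i) * (1 + N j * d)"
      using \<open>0 \<le> d\<close> by (intro mult_left_mono) auto
    then show ?thesis
      using norm_c[of j i] by simp
  qed
  then have c_norm_summable: "summable (\<lambda>i. norm (c j i))" for j
    by (intro summable_comparison_test'[OF summable_geometric[of "1/2 :: real"], of 0]) auto
  then have c_summable: "summable (c j)" for j
    by (rule summable_norm_cancel)
  define C where "C j = suminf (c j)" for j
  have C_mem: "C j \<in> thompson_banach_algebra" for j
    unfolding C_def
    by (intro thompson_suminf c_summable) (simp add: c_def thompson_closed_under W_mem a_mem)
  have norm_C: "norm (C j) * (1 + N j * d) \<le> 2" for j
  proof -
    have "norm (C j) * (1 + N j * d) \<le> (\<Sum>i. norm (c j i)) * (1 + N j * d)"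
      unfolding C_def using \<open>0 \<le> d\<close> c_norm_summable
      by (intro mult_right_mono summable_norm) auto
    also have "\<dots> = (\<Sum>i. norm (c j i) * (1 + N j * d))"
      by (rule suminf_mult2[OF c_norm_summable])
    also have "\<dots> \<le> (\<Sum>i. (1/2 :: real) ^ i)"
      by (intro suminf_le norm_c summable_mult2 c_norm_summable summable_geometric) auto
    also have "\<dots> = 2"
      by (simp add: suminf_geometric)
    finally show ?thesis .
  qed
  have C_split: "C 0 = S j + (W (N j) o\<^sub>L C j)" for j
  proof -
    have "c 0 (i + j) = W (N j) o\<^sub>L c j i" for i
    proof -
      have "W (N (i + j)) = W (N j) o\<^sub>L W (N (i + j) - N j)"
        using N_mono[of j i] by (simp flip: W_add)
      then show ?thesis
        by (simp add: c_def N_0 blinfun_compose_assoc)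
    qed
    then have "C 0 = (\<Sum>i. W (N j) o\<^sub>L c j i) + (\<Sum>i<j. c 0 i)"
      unfolding C_def using suminf_split_initial_segment[OF c_summable[of 0], of j] by simp
    also have "(\<Sum>i. W (N j) o\<^sub>L c j i) = W (N j) o\<^sub>L C j"
      unfolding C_def
      by (rule bounded_linear.suminf[symmetric, OF _ c_summable])
        (rule bounded_bilinear.bounded_linear_right[OF bounded_bilinear_blinfun_compose])
    also have "(\<Sum>i<j. c 0 i) = S j"
      by (simp add: S_sum c_def N_0)
    finally show ?thesis
      by (simp add: add.commute)
  qed
  obtain j :: nat where j: "norm (D (C 0)) \<le> j"
    using real_arch_simple by blast
  let ?P = "length_cutoff (N (Suc j))"
  have P_le: "norm (?P o\<^sub>L X) \<le> norm X" for X
    using norm_blinfun_compose[of ?P X] norm_length_cutoff_le[of "N (Suc j)"]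
    by (meson mult_left_le_one_le norm_ge_zero order_trans)
  have "D (C 0) = D (S j) + (W (N j) o\<^sub>L D (a j)) + (D (W (N j)) o\<^sub>L a j)
      + ((W (N (Suc j)) o\<^sub>L D (C (Suc j))) + (D (W (N (Suc j))) o\<^sub>L C (Suc j)))"
    unfolding C_split[of "Suc j"] S_Suc
    by (simp add: D_add D_mult thompson_closed_under S_mem W_mem a_mem C_mem)
  then have "W (N j) o\<^sub>L D (a j) = D (C 0) - D (S j) - (D (W (N j)) o\<^sub>L a j)
      - (D (W (N (Suc j))) o\<^sub>L C (Suc j)) - (W (N (Suc j)) o\<^sub>L D (C (Suc j)))"
    by (simp add: algebra_simps)
  then have "?P o\<^sub>L (W (N j) o\<^sub>L D (a j)) = (?P o\<^sub>L (D (C 0) - D (S j) - (D (W (N j)) o\<^sub>L a j)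
      - (D (W (N (Suc j))) o\<^sub>L C (Suc j)))) - ((?P o\<^sub>L W (N (Suc j))) o\<^sub>L D (C (Suc j)))"
    by (simp add: blinfun_compose_assoc 
        bounded_bilinear.diff_right[OF bounded_bilinear_blinfun_compose])
  \<comment> \<open>The derivative of the tail itself, which is not under control, is cut off.\<close>
  moreover have "?P o\<^sub>L W (N (Suc j)) = 0"
    using cutoff_W[of "N (Suc j)" 0] by simp
  moreover have "?P o\<^sub>L (W (N j) o\<^sub>L D (a j)) = W (N j) o\<^sub>L (length_cutoff (k j) o\<^sub>L D (a j))"
    using cutoff_W[of "N j" "k j"] by (simp add: N_Suc flip: blinfun_compose_assoc)
  ultimately have "norm (length_cutoff (k j) o\<^sub>L D (a j))
      = norm (?P o\<^sub>L (D (C 0) - D (S j) - (D (W (N j)) o\<^sub>L a j) - (D (W (N (Suc j))) o\<^sub>L C (Suc j))))"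
    using norm_W[of "N j" "length_cutoff (k j) o\<^sub>L D (a j)"] by simp
  also have "\<dots> \<le> norm (D (C 0) - D (S j) - (D (W (N j)) o\<^sub>L a j) - (D (W (N (Suc j))) o\<^sub>L C (Suc j)))"
    by (rule P_le)
  also have "\<dots> \<le> norm (D (C 0)) + norm (D (S j)) + norm (D (W (N j)) o\<^sub>L a j)
      + norm (D (W (N (Suc j))) o\<^sub>L C (Suc j))"
    by (intro order_trans[OF norm_triangle_ineq4] add_mono order_refl)
  also have "norm (D (W (N j)) o\<^sub>L a j) \<le> 1"
  proof -
    have "norm (D (W (N j)) o\<^sub>L a j) \<le> N j * d * norm (a j)"
      using norm_blinfun_compose norm_DW by (meson mult_right_mono norm_ge_zero order_trans)
    also have "\<dots> \<le> norm (a j) * (1 + N j * d)"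
      by (simp add: algebra_simps)
    also have "\<dots> \<le> (1/2) ^ j"
      by (rule a_small)
    finally show ?thesis
      using power_le_one[of "1/2 :: real" j] by simp
  qed
  also have "norm (D (W (N (Suc j))) o\<^sub>L C (Suc j)) \<le> 2"
  proof -
    have "norm (D (W (N (Suc j))) o\<^sub>L C (Suc j)) \<le> N (Suc j) * d * norm (C (Suc j))"
      using norm_blinfun_compose norm_DW by (meson mult_right_mono norm_ge_zero order_trans)
    also have "\<dots> \<le> norm (C (Suc j)) * (1 + N (Suc j) * d)"
      by (simp add: algebra_simps)
    finally show ?thesis
      using norm_C[of "Suc j"] by simp
  qed
  finally have "norm (length_cutoff (k j) o\<^sub>L D (a j)) \<le> j + norm (D (S j)) + 3"
    using j by simp
  then show False
    using DA_big[of j "S j" "N j"] by (simp add: k_def a_def)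
qed

end

section \<open>The values of a derivation on the generators\<close>

lemma gen_pair_eq_iff:
  "gen a * gen b = gen c * gen d \<longleftrightarrow> insert_gen a [b] = insert_gen c [d]"
  by (metis normal_form_gen normal_form_gen_times normal_form_inject)

lemma coord_left_translate_pair_eq_0:
  assumes "\<And>k. insert_gen p [q] \<noteq> insert_gen i [k]"
  shows "coord (blinfun_apply (left_translate (gen i)) g) (gen p * gen q) = 0"
proof (rule coord_left_translate_outside, rule notI)
  assume "gen p * gen q \<in> range ((*) (gen i))"
  then obtain v where v: "gen p * gen q = gen i * v"
    by blast
  have "len (gen p * gen q) = len (gen i * v)"
    by (simp only: v)
  then have "len v = 1"
    by simp
  then obtain k where "v = gen k"
    by (rule len_eq_1E)
  then show False
    using v assms by (auto simp: gen_pair_eq_iff)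
qed

lemma coord_right_translate_pair_eq_0:
  assumes "\<And>k. insert_gen p [q] \<noteq> insert_gen k [i]"
  shows "coord (right_translate (gen i) g) (gen p * gen q) = 0"
proof (rule coord_right_translate_outside, rule notI)
  fix v
  assume v: "gen p * gen q = v * gen i"
  have "len (gen p * gen q) = len (v * gen i)"
    by (simp only: v)
  then have "len v = 1"
    by simp
  then obtain k where "v = gen k"
    by (rule len_eq_1E)
  then show False
    using v assms by (auto simp: gen_pair_eq_iff)
qed

context thompson_derivation
begin

definition cocycle :: "thompson \<Rightarrow> thompson ell2" where
  "cocycle s = blinfun_apply (D (left_translate s)) (delta 1)"

lemma D_left_translate_delta:
  "blinfun_apply (D (left_translate s)) (delta t) = right_translate t (cocycle s)"
  unfolding cocycle_def
  by (intro right_commutant_apply_delta subsetD[OF thompson_subset_right_commutant] D_mem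
      left_translate_mem)

lemma cocycle_mult:
  "cocycle (s * t) = blinfun_apply (left_translate s) (cocycle t) + right_translate t (cocycle s)"
  using D_left_translate_delta[of s t]
  by (simp add: cocycle_def left_translate_mult D_mult left_translate_mem blinfun.add_left
      left_translate_delta)

text \<open>The two expressions for \<open>c\<close> at the defining relation of the semigroup, coordinate by coordinate.
  Information about single values is gained by choosing \<open>y\<close> such that most terms vanish.\<close>

lemma cocycle_relation:
  assumes "i < j"
  shows "coord (blinfun_apply (left_translate (gen j)) (cocycle (gen i))) y
      + coord (right_translate (gen i) (cocycle (gen j))) y
    = coord (blinfun_apply (left_translate (gen i)) (cocycle (gen (Suc j)))) y
      + coord (right_translate (gen (Suc j)) (cocycle (gen i))) y"
  using gen_relation[OF assms] cocycle_mult[of "gen j" "gen i"] cocycle_mult[of "gen i" "gen (Suc j)"]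
  by (metis plus_ell2.rep_eq)

lemma D_left_translate_bounded: "\<exists>K\<ge>0. \<forall>s. norm (D (left_translate s)) \<le> K"
proof -
  obtain K where K: "\<And>A. A \<in> thompson_banach_algebra \<Longrightarrow> norm (D A) \<le> K * norm A"
    using D_bounded by blast
  have "norm (D (left_translate s)) \<le> max K 0" for s
  proof -
    have "norm (D (left_translate s)) \<le> K * norm (left_translate s)"
      by (rule K[OF left_translate_mem])
    also have "\<dots> \<le> max K 0 * norm (left_translate s)"
      by (intro mult_right_mono) auto
    also have "\<dots> \<le> max K 0 * 1"
      by (intro mult_left_mono norm_left_translate_le) auto
    finally show ?thesis
      by simp
  qed
  then show ?thesis
    by (intro exI[of _ "max K 0"]) auto
qed

text \<open>On powers of \<open>s\<close> the cocycle identity makes the diagonal value additive.\<close>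

lemma coord_cocycle_power: "coord (cocycle (s ^ n)) (s ^ n) = of_nat n * coord (cocycle s) s"
proof (induction n)
  case 0
  then show ?case
    by (simp add: cocycle_def D_left_translate_one zero_ell2.rep_eq)
next
  case (Suc n)
  have "coord (cocycle (s ^ Suc n)) (s * s ^ n)
      = coord (cocycle (s ^ n)) (s ^ n) + coord (cocycle s) s"
    unfolding power_Suc cocycle_mult plus_ell2.rep_eq
    by (simp only: coord_left_translate_times coord_right_translate_times)
  with Suc show ?case
    by (simp add: algebra_simps)
qed

text \<open>On the algebra spanned by the translations, \<open>L\<^sub>s \<mapsto> len s L\<^sub>s\<close> is a derivation with nonzero diagonal
  values; it is boundedness that excludes it.\<close>

lemma coord_cocycle_diagonal: "coord (cocycle s) s = 0"
proof (rule ccontr)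
  assume "coord (cocycle s) s \<noteq> 0"
  then have pos: "0 < cmod (coord (cocycle s) s)"
    by simp
  obtain K where K: "\<And>s. norm (D (left_translate s)) \<le> K"
    using D_left_translate_bounded by blast
  have "real n * cmod (coord (cocycle s) s) \<le> K" for n
  proof -
    have "real n * cmod (coord (cocycle s) s) = cmod (coord (cocycle (s ^ n)) (s ^ n))"
      by (simp add: coord_cocycle_power norm_mult)
    also have "\<dots> \<le> norm (cocycle (s ^ n))"
      by (rule norm_coord_le)
    also have "\<dots> \<le> norm (D (left_translate (s ^ n)))"
      using norm_blinfun[of "D (left_translate (s ^ n))" "delta 1"] by (simp add: cocycle_def)
    also have "\<dots> \<le> K"
      by (rule K)
    finally show ?thesis .
  qed
  then show False
    using ex_less_of_nat_mult[OF pos, of K] by (meson not_le)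
qed

text \<open>The part of \<open>c\<close> that preserves length, at the generators. Evaluated at a suitable word of length
  2, all but one of the four terms of the relation vanish (in the case of \<open>X\<^sub>1\<close> at \<open>X\<^sub>0\<close>, all but
  two, one of which is known).\<close>

lemma coord_cocycle_gen_gen: "coord (cocycle (gen i)) (gen m) = 0"
proof -
  have above: "coord (cocycle (gen i)) (gen m) = 0" if "i < m" for i m
    using cocycle_relation[of i m "gen m * gen m"] that
    by (simp add: coord_left_translate_pair_eq_0 coord_right_translate_pair_eq_0)
  have far: "coord (cocycle (gen j)) (gen m) = 0" if "Suc m < j" for j m
    using cocycle_relation[of "Suc m" j "gen m * gen (Suc m)"] that
    by (simp add: coord_left_translate_pair_eq_0 coord_right_translate_pair_eq_0)
  have near: "coord (cocycle (gen (Suc m))) (gen m) = 0" for m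
  proof (cases m)
    case 0
    then show ?thesis
      using cocycle_relation[of 0 1 "gen 0 * gen 0"] far[of 0 2]
      by (simp add: coord_left_translate_pair_eq_0 coord_right_translate_pair_eq_0
          numeral_2_eq_2)
  next
    case (Suc p)
    then show ?thesis
      using cocycle_relation[of p m "gen p * gen m"]
      by (simp add: coord_left_translate_pair_eq_0 coord_right_translate_pair_eq_0)
  qed
  consider "i < m" | "i = m" | "i = Suc m" | "Suc m < i"
    by linarith
  then show ?thesis
    using above far near coord_cocycle_diagonal by cases auto
qed

section \<open>The symbol of the implementing operator\<close>

text \<open>The coordinates of \<open>- L\<^sub>s\<^sup>* c s\<close> for \<open>s = X\<^sub>n\<close> are eventually constant in \<open>n\<close>; this is their limit, taken at
  an index at which \<open>cocycle_large_gen\<close> guarantees that it is attained.\<close>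

definition symbol :: "thompson \<Rightarrow> complex" where
  "symbol v = - coord (cocycle (gen (bound v))) (gen (bound v) * v)"

text \<open>The relation for \<open>m < n\<close> at \<open>X\<^sub>n X\<^sub>m v = X\<^sub>m X\<^sub>n\<^sub>+\<^sub>1 v\<close>. For \<open>v \<noteq> 1\<close> this element is neither
  right divisible by \<open>X\<^sub>m\<close> nor by \<open>X\<^sub>n\<^sub>+\<^sub>1\<close>, which removes both right translates.\<close>

lemma cocycle_shift:
  assumes v: "\<forall>k\<in>letters v. k < m" and n: "m + len v < n"
  shows "coord (cocycle (gen m)) (gen m * v) = coord (cocycle (gen (Suc n))) (gen (Suc n) * v)"
proof (cases "v = 1")
  case True
  then show ?thesis
    by (simp add: coord_cocycle_diagonal)
next
  case False
  then have "0 < len v"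
    using len_eq_0_iff by blast
  let ?y = "gen n * (gen m * v)"
  have mv: "letters (gen m * v) = insert (m + len v) (letters v)"
    by (rule letters_large_gen_times[OF v])
  then have mv_less: "\<forall>k\<in>letters (gen m * v). k < n"
    using v n by auto
  have y: "?y = gen m * (gen (Suc n) * v)"
    using gen_relation[of m n] n by (simp flip: mult.assoc)
  have "coord (right_translate (gen m) (cocycle (gen n))) ?y = 0"
  proof (rule coord_right_translate_outside, rule notI)
    fix w
    assume "?y = w * gen m"
    then obtain w' where "w' * gen m = gen m * v"
      using large_gen_divides_left_factor[of w "gen m" n "gen m * v"] mv_less n by auto
    then have "m \<in> insert (m + len v) (letters v)"
      using mem_letters_times_gen[of m w'] mv by simp
    then show False
      using v \<open>0 < len v\<close> by auto
  qed
  moreover have "coord (right_translate (gen (Suc n)) (cocycle (gen m))) ?y = 0"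
  proof (rule coord_right_translate_outside, rule notI)
    fix w
    assume "?y = w * gen (Suc n)"
    then have "Suc n \<in> letters ?y"
      using mem_letters_times_gen[of "Suc n" w] by simp
    also have "letters ?y = insert (n + Suc (len v)) (insert (m + len v) (letters v))"
      using letters_large_gen_times[OF mv_less] mv by simp
    finally show False
      using v n \<open>0 < len v\<close> by auto
  qed
  moreover have "coord (blinfun_apply (left_translate (gen m)) (cocycle (gen (Suc n)))) ?y
      = coord (cocycle (gen (Suc n))) (gen (Suc n) * v)"
    unfolding y by simp
  ultimately show ?thesis
    using cocycle_relation[of m n ?y] n by simp
qed

lemma cocycle_large_gen:
  assumes "\<forall>k\<in>letters v. k < m"
  shows "coord (cocycle (gen m)) (gen m * v) = - symbol v"
proof -
  \<comment> \<open>Two indices beyond the letters of \<open>v\<close> are compared through a third one that is larger than both.\<close>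
  let ?n = "Suc (m + bound v + len v)"
  have "coord (cocycle (gen m)) (gen m * v) = coord (cocycle (gen (Suc ?n))) (gen (Suc ?n) * v)"
    using assms by (intro cocycle_shift) auto
  also have "\<dots> = coord (cocycle (gen (bound v))) (gen (bound v) * v)"
    by (intro cocycle_shift[symmetric]) (auto intro: letters_less_bound)
  finally show ?thesis
    by (simp add: symbol_def)
qed

text \<open>The relation for \<open>i < n\<close> at \<open>X\<^sub>n t\<close> with \<open>n\<close> large. Its first term is \<open>c X\<^sub>i\<close> at \<open>t\<close>, and the division
  lemmas identify the terms with the large generator as values of the symbol. The
  last term is supported on the multiples of \<open>X\<^sub>n\<^sub>+\<^sub>1\<close>; it disappears because \<open>X\<^sub>n t\<close> ends in the
  letter \<open>n\<close> plus the length of \<open>t\<close>. If \<open>t\<close> has length 1 this letter is \<open>n + 1\<close>, the last term equals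
  the first and the relation says nothing; then both sides of the claim vanish for another reason.\<close>

lemma cocycle_gen_eq_commutator:
  assumes f: "coord f = symbol"
  shows "cocycle (gen i) = right_translate (gen i) f - blinfun_apply (left_translate (gen i)) f"
proof (rule ell2_eqI)
  fix t
  have "coord (cocycle (gen i)) t
    = coord (right_translate (gen i) f) t - coord (blinfun_apply (left_translate (gen i)) f) t"
  proof (cases "len t = 1")
    case True
    then obtain m where t: "t = gen m"
      by (rule len_eq_1E)
    have f1: "coord f 1 = 0"
      by (simp add: f symbol_def coord_cocycle_diagonal)
    have "coord (right_translate (gen i) f) t = 0"
    proof (cases "m = i")
      case True
      then show ?thesis
        using coord_right_translate_times[of "gen i" f 1] f1 t by simp
    next
      case False
      have "gen m \<noteq> v * gen i" for v
      proof
        assume v: "gen m = v * gen i"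
        then have "len (gen m) = len (v * gen i)"
          by (simp only:)
        then have "v = 1"
          by simp
        then show False
          using v False by simp
      qed
      then show ?thesis
        by (simp add: t coord_right_translate_outside)
    qed
    moreover have "coord (blinfun_apply (left_translate (gen i)) f) t = 0"
    proof (cases "m = i")
      case True
      then show ?thesis
        using coord_left_translate_times[of "gen i" f 1] f1 t by simp
    next
      case False
      have "gen m \<noteq> gen i * v" for v
      proof
        assume v: "gen m = gen i * v"
        then have "len (gen m) = len (gen i * v)"
          by (simp only:)
        then have "v = 1"
          by simp
        then show False
          using v False by simp
      qed
      then show ?thesis
        by (auto simp: t intro!: coord_left_translate_outside)
    qed
    ultimately show ?thesis
      by (simp add: t coord_cocycle_gen_gen)
  next
    case False
    obtain n where n: "i < n" "bound t \<le> n" "\<And>w. t = w * gen i \<Longrightarrow> bound w \<le> n"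
    proof (cases "\<exists>w. t = w * gen i")
      case True
      then obtain w where w: "t = w * gen i"
        by blast
      show ?thesis
      proof (rule that[of "Suc (i + bound t + bound w)"])
        fix w'
        assume "t = w' * gen i"
        then have "w' = w"
          using w thompson_right_cancel by metis
        then show "bound w' \<le> Suc (i + bound t + bound w)"
          by simp
      qed auto
    next
      case False
      then show ?thesis
        using that[of "Suc (i + bound t)"] by auto
    qed
    have t_less: "\<forall>k\<in>letters t. k < n"
      using letters_less_bound n(2) by blast
    let ?y = "gen n * t"
    have "coord (right_translate (gen i) (cocycle (gen n))) ?y = - coord (right_translate (gen i) f) t"
    proof (cases "\<exists>w. t = w * gen i")
      case True
      then obtain w where w: "t = w * gen i"
        by blast
      have "coord (right_translate (gen i) (cocycle (gen n))) (gen n * w * gen i) = - symbol w"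
        unfolding coord_right_translate_times
        using n(3)[OF w] letters_less_bound by (intro cocycle_large_gen) blast
      then show ?thesis
        by (simp add: w f mult.assoc)
    next
      case False
      have "?y \<noteq> w * gen i" for w
      proof
        assume "?y = w * gen i"
        moreover have "n + len t \<notin> letters (gen i)"
          using n(1) by simp
        ultimately obtain w' where "w' * gen i = t"
          using large_gen_divides_left_factor[of w "gen i" n t] t_less by metis
        then show False
          using False by blast
      qed
      with False show ?thesis
        by (simp add: coord_right_translate_outside)
    qed
    moreover have "coord (right_translate (gen (Suc n)) (cocycle (gen i))) ?y = 0"
    proof (rule coord_right_translate_outside, rule notI)
      fix w
      assume "?y = w * gen (Suc n)"
      then have "Suc n \<in> insert (n + len t) (letters t)"
        using mem_letters_times_gen[of "Suc n" w] letters_large_gen_times[OF t_less] by simp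
      then show False
        using t_less False by auto
    qed
    moreover have "coord (blinfun_apply (left_translate (gen i)) (cocycle (gen (Suc n)))) ?y
        = - coord (blinfun_apply (left_translate (gen i)) f) t"
    proof (cases "\<exists>z. t = gen i * z")
      case True
      then obtain z where z: "t = gen i * z"
        by blast
      have "?y = gen i * (gen (Suc n) * z)"
        using gen_relation[OF n(1)] by (simp add: z flip: mult.assoc)
      moreover have "coord (cocycle (gen (Suc n))) (gen (Suc n) * z) = - symbol z"
        using letters_right_factor[of z "gen i"] t_less
        by (intro cocycle_large_gen) (auto simp: z less_Suc_eq)
      ultimately show ?thesis
        by (simp add: z f)
    next
      case False
      have "?y \<noteq> gen i * z" for z
      proof
        assume "?y = gen i * z"
        then show False
          using gen_times_eq_large_gen_times[OF _ t_less, of i z] n(1) False by (metis less_irrefl)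
      qed
      then have "?y \<notin> range ((*) (gen i))" "t \<notin> range ((*) (gen i))"
        using False by auto
      then show ?thesis
        by (simp add: coord_left_translate_outside)
    qed
    ultimately show ?thesis
      using cocycle_relation[OF n(1), of ?y] by (simp add: algebra_simps)
  qed
  then show "coord (cocycle (gen i)) t
      = coord (right_translate (gen i) f - blinfun_apply (left_translate (gen i)) f) t"
    by (simp add: minus_ell2.rep_eq)
qed

section \<open>Boundedness of the implementing operator\<close>

text \<open>On the finite set \<open>F\<close> only finitely many coordinates of \<open>g\<close> and of the symbol enter into the
  convolution, so a single generator \<open>X\<^sub>n\<close> serves for all of them: the values of \<open>- (symbol * g)\<close> on \<open>F\<close> are
  the values on \<open>X\<^sub>n F\<close> of \<open>D L\<^sub>s\<close>, \<open>s = X\<^sub>n\<close>, applied to the truncation of \<open>g\<close> to \<open>G\<close>. The truncation matters: a coordinate of \<open>g\<close> at an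
  element with the letter \<open>n + len v\<close> would contribute further terms.\<close>

lemma sum_convolution_symbol_le:
  assumes K: "0 \<le> K" "\<And>s. norm (D (left_translate s)) \<le> K" and F: "finite F"
  shows "(\<Sum>v\<in>F. (cmod (convolution symbol (coord g) v))\<^sup>2) \<le> (K * norm g)\<^sup>2"
proof -
  define G where "G = (\<Union>v\<in>F. snd ` factorizations v)"
  define P where "P = (\<Union>v\<in>F. factorizations v)"
  have "finite G" "finite P"
    using F by (auto simp: G_def P_def finite_factorizations)
  define n where "n = Max (insert 0 (bound ` (F \<union> G \<union> fst ` P)))"
  have n: "bound x \<le> n" if "x \<in> F \<union> G \<union> fst ` P" for x
    unfolding n_def using that F \<open>finite G\<close> \<open>finite P\<close> by (intro Max_ge) auto
  have less: "\<forall>k\<in>letters x. k < n" if "x \<in> F \<union> G \<union> fst ` P" for x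
    using n[OF that] letters_less_bound by blast
  let ?A = "D (left_translate (gen n))"
  let ?h = "\<lambda>v u. coord g u * coord (right_translate u (cocycle (gen n))) (gen n * v)"
  have A: "?A \<in> bounded_ops"
    using D_mem[OF left_translate_mem] thompson_subset_right_commutant
    by (auto simp: right_commutant_def)
  have "convolution symbol (coord g) v = - coord (blinfun_apply ?A (restrict_ell2 G g)) (gen n * v)"
    if "v \<in> F" for v
  proof -
    have "coord (blinfun_apply ?A (restrict_ell2 G g)) (gen n * v) = (\<Sum>u\<in>G. ?h v u)"
      using bounded_ops_restrict[OF A \<open>finite G\<close>, of g]
      by (simp add: coord_sum cscale.rep_eq D_left_translate_delta)
    also have "\<dots> = (\<Sum>u\<in>snd ` factorizations v. ?h v u)"
    proof (rule sum.mono_neutral_right[OF \<open>finite G\<close>])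
      show "snd ` factorizations v \<subseteq> G"
        using that by (auto simp: G_def)
      have "coord (right_translate u (cocycle (gen n))) (gen n * v) = 0"
        if u: "u \<in> G - snd ` factorizations v" for u
      proof (rule coord_right_translate_outside, rule notI)
        fix w
        assume w: "gen n * v = w * u"
        have "\<forall>k\<in>letters v. k < n" "n + len v \<notin> letters u"
          using less[of v] less[of u] u \<open>v \<in> F\<close> by auto
        then obtain w' where "w' * u = v"
          using large_gen_divides_left_factor[OF w[symmetric]] by blast
        then show False
          using u by (force simp: factorizations_def)
      qed
      then show "\<forall>u\<in>G - snd ` factorizations v. ?h v u = 0"
        by simp
    qed
    also have "\<dots> = (\<Sum>p\<in>factorizations v. ?h v (snd p))"
      by (simp add: sum.reindex[OF inj_on_snd_factorizations])
    also have "\<dots> = (\<Sum>(w, u)\<in>factorizations v. - (symbol w * coord g u))"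
    proof (rule sum.cong[OF HOL.refl])
      fix p
      assume p: "p \<in> factorizations v"
      obtain w u where wu: "p = (w, u)"
        by force
      have "coord (right_translate u (cocycle (gen n))) (gen n * w * u) = - symbol w"
        unfolding coord_right_translate_times
        by (intro cocycle_large_gen less) (use p \<open>v \<in> F\<close> wu in \<open>force simp: P_def\<close>)
      moreover have "gen n * w * u = gen n * v"
        using p wu by (simp add: factorizations_def mult.assoc)
      ultimately show "?h v (snd p) = (case p of (w, u) \<Rightarrow> - (symbol w * coord g u))"
        by (simp add: wu)
    qed
    also have "\<dots> = - convolution symbol (coord g) v"
      by (simp add: convolution_eq_sum case_prod_unfold sum_negf)
    finally show ?thesis
      by simp
  qed
  then have "(\<Sum>v\<in>F. (cmod (convolution symbol (coord g) v))\<^sup>2)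
      = (\<Sum>v\<in>F. (cmod (coord (blinfun_apply ?A (restrict_ell2 G g)) (gen n * v)))\<^sup>2)"
    by simp
  also have "\<dots> = (\<Sum>x\<in>(*) (gen n) ` F. (cmod (coord (blinfun_apply ?A (restrict_ell2 G g)) x))\<^sup>2)"
    by (subst sum.reindex) (auto simp: inj_on_def dest: thompson_left_cancel)
  also have "\<dots> \<le> (norm (blinfun_apply ?A (restrict_ell2 G g)))\<^sup>2"
    using F by (intro sum_coord_le_norm) auto
  also have "\<dots> \<le> (K * norm g)\<^sup>2"
  proof (rule power_mono)
    have "norm (blinfun_apply ?A (restrict_ell2 G g)) \<le> norm ?A * norm (restrict_ell2 G g)"
      by (rule norm_blinfun)
    also have "\<dots> \<le> K * norm g"
      using K by (intro mult_mono norm_restrict_ell2_le) auto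
    finally show "norm (blinfun_apply ?A (restrict_ell2 G g)) \<le> K * norm g" .
  qed simp
  finally show ?thesis .
qed

text \<open>The operator is defined by its matrix, that is, as the convolution by the symbol; that the symbol
  is itself square summable follows by applying it to \<open>\<delta>\<^sub>1\<close>.\<close>

lemma implementing_operator:
  obtains f T where "coord f = symbol" "T \<in> bounded_ops" "is_left_convolution f T"
proof -
  obtain K where K: "0 \<le> K" "\<And>s. norm (D (left_translate s)) \<le> K"
    using D_left_translate_bounded by blast
  let ?S = "\<lambda>g. Abs_ell2 (convolution symbol (coord g))"
  have coord_S: "coord (?S g) = convolution symbol (coord g)" and norm_S: "norm (?S g) \<le> K * norm g" for g
    using square_summable_if_sums_bounded[of "convolution symbol (coord g)" "K * norm g"]
      sum_convolution_symbol_le[OF K] K(1) by auto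
  have "bounded_linear ?S"
  proof (rule bounded_linear_intro)
    show "?S (g + h) = ?S g + ?S h" for g h
      by (rule ell2_eqI, unfold coord_S plus_ell2.rep_eq[of "?S g"])
        (simp add: plus_ell2.rep_eq convolution_eq_sum case_prod_unfold distrib_left sum.distrib)
    show "?S (r *\<^sub>R g) = r *\<^sub>R ?S g" for r g
      by (rule ell2_eqI, unfold coord_S scaleR_ell2.rep_eq[of r "?S g"])
        (simp add: scaleR_ell2.rep_eq convolution_eq_sum case_prod_unfold sum_distrib_left
          mult.left_commute)
    show "norm (?S g) \<le> norm g * K" for g
      using norm_S[of g] by (simp add: mult.commute)
  qed
  then have T: "blinfun_apply (Blinfun ?S) = ?S"
    by (rule bounded_linear_Blinfun_apply)
  have "?S (cscale c g) = cscale c (?S g)" for c g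
    by (rule ell2_eqI, unfold coord_S cscale.rep_eq[of c "?S g"])
      (simp add: cscale.rep_eq convolution_eq_sum case_prod_unfold sum_distrib_left
        mult.left_commute)
  then have "Blinfun ?S \<in> bounded_ops"
    by (simp add: bounded_ops_def T)
  moreover have f: "coord (?S (delta 1)) = symbol"
    using convolution_delta_right[of symbol 1] by (auto simp: coord_S)
  moreover have "is_left_convolution (?S (delta 1)) (Blinfun ?S)"
    unfolding is_left_convolution_def T f by (simp only: coord_S) simp
  ultimately show thesis
    using that by blast
qed

section \<open>From the generators to the Banach algebra\<close>

lemma D_gen_eq_commutator:
  assumes f: "coord f = symbol" and T: "T \<in> bounded_ops" "is_left_convolution f T"
  shows "D (left_translate (gen i)) = (T o\<^sub>L left_translate (gen i)) - (left_translate (gen i) o\<^sub>L T)"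
proof (rule bounded_ops_eqI)
  let ?L = "left_translate (gen i)"
  show "D ?L \<in> bounded_ops"
    using D_mem[OF left_translate_mem] thompson_subset_right_commutant
    by (auto simp: right_commutant_def)
  have "T o\<^sub>L ?L \<in> bounded_ops" "?L o\<^sub>L T \<in> bounded_ops"
    using T(1) left_translate_in_bounded_ops subalgebra_bounded_ops by (auto simp: subalgebra_def)
  then show "(T o\<^sub>L ?L) - (?L o\<^sub>L T) \<in> bounded_ops"
    by (rule subalgebra_diff[OF subalgebra_bounded_ops])
  fix u
  have "right_translate u (blinfun_apply ?L f) = blinfun_apply ?L (right_translate u f)"
    using left_translate_in_right_commutant by (simp add: right_commutant_def)
  then show "blinfun_apply (D ?L) (delta u) = blinfun_apply ((T o\<^sub>L ?L) - (?L o\<^sub>L T)) (delta u)"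
    by (simp add: D_left_translate_delta cocycle_gen_eq_commutator[OF f] blinfun.diff_left
        left_translate_delta left_convolution_apply_delta[OF T(2)] right_translate_mult
        linear_diff[OF bounded_linear.linear[OF bounded_linear_right_translate]])
qed

lemma D_continuous:
  assumes A: "\<And>n. X n \<in> thompson_banach_algebra" "X \<longlonglongrightarrow> A" "A \<in> thompson_banach_algebra"
  shows "(\<lambda>n. D (X n)) \<longlonglongrightarrow> D A"
proof -
  obtain K where K: "\<And>A. A \<in> thompson_banach_algebra \<Longrightarrow> norm (D A) \<le> K * norm A"
    using D_bounded by blast
  have "D (X n) - D A = D (X n - A)" for n
    using D_add[of "X n - A" A] subalgebra_diff[OF subalgebra_thompson A(1) A(3)] A(3) by simp
  then have le: "norm (D (X n) - D A) \<le> K * norm (X n - A)" for n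
    using K[OF subalgebra_diff[OF subalgebra_thompson A(1) A(3)]] by simp
  have "(\<lambda>n. K * norm (X n - A)) \<longlonglongrightarrow> 0"
    using tendsto_mult_right_zero[OF tendsto_norm_zero[OF LIM_zero[OF A(2)]]] by simp
  then have "(\<lambda>n. D (X n) - D A) \<longlonglongrightarrow> 0"
    by (rule Lim_null_comparison[OF always_eventually[OF allI[OF le]]])
  then show ?thesis
    by (rule LIM_zero_cancel)
qed

text \<open>The elements at which \<open>D\<close> agrees with the commutator form a subalgebra because both are
  derivations, and a closed one because both are continuous.\<close>

lemma D_eq_commutator:
  assumes T: "T \<in> bounded_ops"
    and gen: "\<And>i. D (left_translate (gen i)) = (T o\<^sub>L left_translate (gen i)) - (left_translate (gen i) o\<^sub>L T)"
    and A: "A \<in> thompson_banach_algebra"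
  shows "D A = (T o\<^sub>L A) - (A o\<^sub>L T)"
proof -
  note compose_simps = bounded_bilinear.add_left[OF bounded_bilinear_blinfun_compose]
    bounded_bilinear.add_right[OF bounded_bilinear_blinfun_compose]
    bounded_bilinear.diff_left[OF bounded_bilinear_blinfun_compose]
    bounded_bilinear.diff_right[OF bounded_bilinear_blinfun_compose]
  let ?E = "{A \<in> thompson_banach_algebra. D A = (T o\<^sub>L A) - (A o\<^sub>L T)}"
  have mult: "A o\<^sub>L B \<in> ?E" if "A \<in> ?E" "B \<in> ?E" for A B
    using that by (simp add: thompson_closed_under D_mult compose_simps blinfun_compose_assoc)
  have "subalgebra ?E"
    unfolding subalgebra_def
  proof (intro conjI ballI allI)
    show "?E \<subseteq> bounded_ops"
      using subalgebra_thompson by (auto simp: subalgebra_def)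
    show "0 \<in> ?E"
      by (simp add: thompson_closed_under D_zero)
    show "A + B \<in> ?E" if "A \<in> ?E" "B \<in> ?E" for A B
      using that by (simp add: thompson_closed_under D_add compose_simps)
    show "scale_op c A \<in> ?E" if "A \<in> ?E" for c A
    proof -
      have "scale_op c ((T o\<^sub>L A) - (A o\<^sub>L T)) = (T o\<^sub>L scale_op c A) - (scale_op c A o\<^sub>L T)"
        by (rule blinfun_eqI)
          (simp add: blinfun.diff_left bounded_ops_cscale[OF T]
            linear_diff[OF bounded_linear.linear[OF bounded_linear_cscale]])
      moreover have "scale_op c A \<in> thompson_banach_algebra"
        using that subalgebra_thompson by (auto simp: subalgebra_def)
      ultimately show ?thesis
        using that by (simp add: D_scale)
    qed
    show "A o\<^sub>L B \<in> ?E" if "A \<in> ?E" "B \<in> ?E" for A B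
      by (rule mult[OF that])
  qed
  moreover have "closed ?E"
    unfolding closed_sequential_limits
  proof (intro allI impI, elim conjE)
    fix X A
    assume X: "\<forall>n. X n \<in> ?E" and lim: "X \<longlonglongrightarrow> A"
    then have A: "A \<in> thompson_banach_algebra"
      by (intro closed_sequentially[OF closed_thompson _ lim]) auto
    have "(\<lambda>n. (T o\<^sub>L X n) - (X n o\<^sub>L T)) \<longlonglongrightarrow> (T o\<^sub>L A) - (A o\<^sub>L T)"
      by (intro tendsto_diff bounded_bilinear.tendsto[OF bounded_bilinear_blinfun_compose]
          tendsto_const lim)
    moreover have "(\<lambda>n. D (X n)) = (\<lambda>n. (T o\<^sub>L X n) - (X n o\<^sub>L T))"
      using X by auto
    moreover have "(\<lambda>n. D (X n)) \<longlonglongrightarrow> D A"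
      using X by (intro D_continuous lim A) auto
    ultimately show "A \<in> ?E"
      using A LIMSEQ_unique by auto
  qed
  moreover have "left_translate s \<in> ?E" for s
  proof (induction s rule: thompson_induct)
    case one
    have "left_translate 1 o\<^sub>L T = T" "T o\<^sub>L left_translate 1 = T"
      by (auto intro: blinfun_eqI simp: left_translate_one)
    then show ?case
      by (simp add: D_left_translate_one left_translate_mem)
  next
    case (gen_times i s)
    then show ?case
      unfolding left_translate_mult by (intro mult) (auto simp: gen left_translate_mem)
  qed
  ultimately have "thompson_banach_algebra \<subseteq> ?E"
    by (intro thompson_banach_algebra_minimal) auto
  with A show ?thesis
    by blast
qed

end

theorem corollary5p9:
  fixes D :: "(thompson ell2 \<Rightarrow>\<^sub>L thompson ell2) \<Rightarrow> (thompson ell2 \<Rightarrow>\<^sub>L thompson ell2)"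
  assumes "derivation_on thompson_banach_algebra D"
  shows "\<exists>T\<in>left_convolution_algebra.
    \<forall>A\<in>thompson_banach_algebra. D A = (T o\<^sub>L A) - (A o\<^sub>L T)"
proof -
  interpret thompson_derivation D
    by unfold_locales (rule assms)
  obtain f T where f: "coord f = symbol" and T: "T \<in> bounded_ops" "is_left_convolution f T"
    by (rule implementing_operator)
  then have "T \<in> left_convolution_algebra"
    by (auto simp: left_convolution_algebra_def)
  moreover have "\<forall>A\<in>thompson_banach_algebra. D A = (T o\<^sub>L A) - (A o\<^sub>L T)"
    using D_eq_commutator[OF T(1) D_gen_eq_commutator[OF f T]] by blast
  ultimately show ?thesis
    by blast
qed

end
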